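(* Let $d \geq 2$ and let $P \subset \mathbb{R}^d$ be a $d$-dimensional lattice polytope with $f^*$-vector $(f^*_0, f^*_1, \dots, f^*_d)$. Then (a) $f^*_0<f^*_1<\cdots<f^*_{\lfloor d/2\rfloor-1}\leq f^*_{\lfloor d/2\rfloor}$; (b) $f^*_{\lfloor 3d/4\rfloor} > f^*_{\lfloor 3d/4\rfloor + 1} > \cdots > f^*_d$; (c) $f^*_k \leq f^*_{d-1-k}$ for all integers $k$ with $0 \leq k \leq \frac{d-3}{2}$.
   Context: A lattice polytope is the convex hull of finitely many points of $\mathbb{Z}^d$. For a $d$-dimensional lattice polytope $P\subset\mathbb{R}^d$ and a positive integer $n$, let $\operatorname{ehr}_P(n)=|nP\cap\mathbb{Z}^d|$; this is a polynomial in $n$ of degree $d$. The $f^*$-vector $(f^*_0,\dots,f^*_d)$ of $P$ is defined by $\operatorname{ehr}_P(n)=\sum_{k=0}^d f^*_k\binom{n-1}{k}$ for all positive integers $n$. *)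

theory Defs
  imports "HOL-Analysis.Analysis"
begin

definition integer_lattice :: "(real ^ 'n) set" where
  "integer_lattice = {x. \<forall>i. x $ i \<in> \<int>}"

definition lattice_polytope :: "(real ^ 'n) set \<Rightarrow> bool" where
  "lattice_polytope P \<longleftrightarrow> (\<exists>V. finite V \<and> V \<subseteq> integer_lattice \<and> P = convex hull V)"

definition ehr :: "(real ^ 'n) set \<Rightarrow> nat \<Rightarrow> nat" where
  "ehr P n = card ((\<lambda>x. real n *\<^sub>R x) ` P \<inter> integer_lattice)"

text \<open>
  Intended for full-dimensional \<open>P\<close>, so that the dimension of \<open>P\<close> is \<open>CARD('n)\<close>. Existence of such
  an \<open>f\<close> is Ehrhart's theorem; the values \<open>f k\<close> for \<open>k \<le> CARD('n)\<close> are determined by \<open>P\<close>, and those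
  beyond are irrelevant.
\<close>
definition fstar_vector :: "(real ^ 'n) set \<Rightarrow> (nat \<Rightarrow> real) \<Rightarrow> bool" where
  "fstar_vector P f \<longleftrightarrow>
     (\<forall>n\<ge>1. real (ehr P n) = (\<Sum>k=0..CARD('n). f k * real ((n - 1) choose k)))"

end

theory Submission
  imports Defs "HOL-Computational_Algebra.Formal_Power_Series"
begin

text \<open>
  The f*-vector is \<open>f k = (\<Sum>j\<le>d. h j * ((d + 1 - j) choose (d - k)))\<close> in terms of the h*-vector, by
  Vandermonde's identity. Parts (a) and (c) then hold termwise because \<open>h\<close> is nonnegative (Stanley).
  In (b) the terms with large \<open>j\<close> have the wrong sign and are compensated by those with small \<open>j\<close>,
  by Hibi's inequality \<open>h d + \<dots> + h (d - i) \<le> h 0 + \<dots> + h (i + 1)\<close>.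

  Both facts about \<open>h\<close> come from half-open decompositions. Linear programming with generic costs
  triangulates the cone over the polytope without new vertices: a generic point lies in the
  cone of exactly one dual feasible basis. Moving the points slightly in a generic direction
  makes the simplicial cones half-open and disjoint, and then \<open>h\<close> counts the lattice points
  in their fundamental boxes by height. Moving inward and outward gives the cone and its
  interior, whose \<open>h\<close> are related by reflecting the boxes; the difference is the boundary, which is
  decomposed in the same way after projecting along an interior direction.
\<close>

section \<open>Optimal bases of a vector configuration\<close>

text \<open>Linear programming stands in for polyhedral geometry: that the simplicial cones do not
  overlap is weak duality, that they cover is the simplex method, and no face structure has to be
  handled. Generic costs exclude ties between bases, generic points exclude degenerate bases.

  The boundary fits the same scheme. A cone point over a given projected point amounts to a conical
  combination of the projected generators, and its height is the total weight; so the boundary is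
  the graph of the optimal value for constant costs. Hence the generic costs have to be close to 1.

  Origin of 3/4 in (b): put a = d - k. The coefficient of h_j in f_k - f_(k+1) is C(m, a) - C(m, a -
  1) with m = d + 1 - j. It is negative only for m \<le> 2a - 2, smallest at m = 2a - 2, and larger
  than the size of that minimum once m \<ge> 2a. Hibi's inequality plays the indices j \<le> 2a - 2
  against those with m \<le> 2a - 2, and the former all have m \<ge> 2a exactly when 4a \<le> d + 3,
  that is k \<ge> floor(3d/4).\<close>

definition poscone :: "'a::real_vector set \<Rightarrow> 'a set" where
  "poscone V = {x. \<exists>l. (\<forall>v\<in>V. 0 \<le> l v) \<and> x = (\<Sum>v\<in>V. l v *\<^sub>R v)}"

definition bases :: "'a::real_vector set \<Rightarrow> 'a set set" where
  "bases V = {B. B \<subseteq> V \<and> independent B \<and> V \<subseteq> span B}"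

text \<open>The dual solution attached to the basis \<open>B\<close> in the program of writing a
  point as a nonnegative combination of \<open>V\<close> at least cost \<open>w\<close>. The bases
  in \<open>opt_bases\<close> are then the strictly dual feasible ones.\<close>

definition price :: "'a::real_vector set \<Rightarrow> ('a \<Rightarrow> real) \<Rightarrow> 'a \<Rightarrow> real" where
  "price B w = construct B w"

definition coord :: "'a::real_vector set \<Rightarrow> 'a \<Rightarrow> 'a \<Rightarrow> real" where
  "coord B b = price B (\<lambda>v. if v = b then 1 else 0)"

definition opt_bases :: "'a::real_vector set \<Rightarrow> ('a \<Rightarrow> real) \<Rightarrow> 'a set set" where
  "opt_bases V w = {B \<in> bases V. \<forall>v\<in>V - B. price B w v < w v}"

lemma basesD:
  assumes "B \<in> bases V"
  shows "B \<subseteq> V" "independent B" "span B = span V"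
  using assms span_mono[of B V] span_minimal[of V "span B"] by (auto simp: bases_def)

lemma opt_basesD:
  assumes "B \<in> opt_bases V w"
  shows "B \<in> bases V" "\<And>v. v \<in> V \<Longrightarrow> v \<notin> B \<Longrightarrow> price B w v < w v"
  using assms by (auto simp: opt_bases_def)

lemma finite_bases: "finite V \<Longrightarrow> finite (bases V)"
  by (rule finite_subset[of _ "Pow V"]) (auto simp: bases_def)

lemma linear_price: "independent B \<Longrightarrow> linear (price B w)"
  unfolding price_def by (rule real_vector.linear_construct)

lemma price_basis: "independent B \<Longrightarrow> b \<in> B \<Longrightarrow> price B w b = w b"
  unfolding price_def by (rule real_vector.construct_basis)

lemma linear_coord: "independent B \<Longrightarrow> linear (coord B b)"
  unfolding coord_def by (rule linear_price)

lemma coord_basis: "independent B \<Longrightarrow> b \<in> B \<Longrightarrow> coord B c b = (if b = c then 1 else 0)"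
  by (simp add: coord_def price_basis)

lemma coord_expand:
  assumes "independent B" "finite B" "x \<in> span B"
  shows "(\<Sum>b\<in>B. coord B b x *\<^sub>R b) = x"
proof (rule linear_eq_on[of _ "\<lambda>x. x", OF _ _ assms(3)])
  show "linear (\<lambda>x. \<Sum>b\<in>B. coord B b x *\<^sub>R b)"
    using linear_coord[OF assms(1)]
    by (intro linear_compose_sum ballI linearI)
       (simp_all add: linear_add linear_cmul scaleR_add_left)
  show "linear (\<lambda>x::'a. x)" by (rule linear_id[unfolded id_def])
  show "(\<Sum>b\<in>B. coord B b c *\<^sub>R b) = c" if "c \<in> B" for c
  proof -
    have "(\<Sum>b\<in>B. coord B b c *\<^sub>R b) = (\<Sum>b\<in>B. if c = b then c else 0)"
      using that by (intro sum.cong) (auto simp: coord_basis assms)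
    then show ?thesis using that assms by simp
  qed
qed

lemma coord_sum:
  assumes "independent B" "finite B" "b \<in> B"
  shows "coord B b (\<Sum>c\<in>B. l c *\<^sub>R c) = l b"
proof -
  have "coord B b (\<Sum>c\<in>B. l c *\<^sub>R c) = (\<Sum>c\<in>B. l c * coord B b c)"
    using linear_coord[OF assms(1)] by (simp add: linear_sum linear_cmul)
  also have "\<dots> = (\<Sum>c\<in>B. if b = c then l c else 0)"
    by (intro sum.cong) (auto simp: coord_basis assms)
  finally show ?thesis using assms by simp
qed

lemma price_sum:
  assumes "independent B"
  shows "price B w (\<Sum>v\<in>A. l v *\<^sub>R v) = (\<Sum>v\<in>A. l v * price B w v)"
  using linear_price[OF assms] by (simp add: linear_sum linear_cmul)

lemma price_coord:
  assumes "independent B" "finite B" "x \<in> span B"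
  shows "price B w x = (\<Sum>b\<in>B. coord B b x * w b)"
proof -
  have "price B w (\<Sum>b\<in>B. coord B b x *\<^sub>R b) = (\<Sum>b\<in>B. coord B b x * w b)"
    unfolding price_sum[OF assms(1)] by (intro sum.cong) (auto simp: price_basis assms)
  then show ?thesis by (simp add: coord_expand assms)
qed

section \<open>Conical combinations and Caratheodory's theorem\<close>

lemma poscone_span: "x \<in> poscone V \<Longrightarrow> x \<in> span V"
  by (auto simp: poscone_def intro: span_sum span_scale span_base)

lemma poscone_add:
  assumes "x \<in> poscone V" "y \<in> poscone V"
  shows "x + y \<in> poscone V"
proof -
  from assms obtain l m where "\<forall>v\<in>V. 0 \<le> l v" "x = (\<Sum>v\<in>V. l v *\<^sub>R v)"
      "\<forall>v\<in>V. 0 \<le> m v" "y = (\<Sum>v\<in>V. m v *\<^sub>R v)"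
    unfolding poscone_def by blast
  then show ?thesis unfolding poscone_def
    by (intro CollectI exI[of _ "\<lambda>v. l v + m v"]) (auto simp: scaleR_add_left sum.distrib)
qed

lemma poscone_scale:
  assumes "x \<in> poscone V" "0 \<le> c"
  shows "c *\<^sub>R x \<in> poscone V"
proof -
  from assms obtain l where "\<forall>v\<in>V. 0 \<le> l v" "x = (\<Sum>v\<in>V. l v *\<^sub>R v)"
    unfolding poscone_def by blast
  then show ?thesis unfolding poscone_def
    by (intro CollectI exI[of _ "\<lambda>v. c * l v"]) (auto simp: scaleR_sum_right assms)
qed

lemma poscone_0: "0 \<in> poscone V"
  unfolding poscone_def by (intro CollectI exI[of _ "\<lambda>_. 0"]) simp

lemma poscone_base:
  assumes "finite V" "v \<in> V"
  shows "v \<in> poscone V"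
proof -
  have "v = (\<Sum>u\<in>V. (if u = v then 1 else 0) *\<^sub>R u)"
    using assms by (simp add: if_distrib[of "\<lambda>t. t *\<^sub>R _"] cong: if_cong)
  then show ?thesis unfolding poscone_def
    by (intro CollectI exI[of _ "\<lambda>u. if u = v then 1 else 0"]) simp
qed

lemma poscone_sum:
  assumes "\<And>i. i \<in> I \<Longrightarrow> 0 \<le> l i" "\<And>i. i \<in> I \<Longrightarrow> e i \<in> poscone V"
  shows "(\<Sum>i\<in>I. l i *\<^sub>R e i) \<in> poscone V"
  using assms
  by (induction I rule: infinite_finite_induct)
     (auto intro: poscone_0 poscone_add poscone_scale)

lemma poscone_mono:
  assumes "finite V" "U \<subseteq> V"
  shows "poscone U \<subseteq> poscone V"
proof
  fix x assume "x \<in> poscone U"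
  then obtain l where l: "\<forall>v\<in>U. 0 \<le> l v" "x = (\<Sum>v\<in>U. l v *\<^sub>R v)"
    unfolding poscone_def by blast
  have "x = (\<Sum>v\<in>V. (if v \<in> U then l v else 0) *\<^sub>R v)"
    unfolding l(2) using assms by (intro sum.mono_neutral_cong_left) auto
  then show "x \<in> poscone V" using l(1) unfolding poscone_def
    by (intro CollectI exI[of _ "\<lambda>v. if v \<in> U then l v else 0"]) auto
qed

text \<open>Subtracting a multiple of a linear relation does not change \<open>y\<close>. The
  multiple is the largest that keeps all coefficients nonnegative, so one of them drops to 0; the
  relation is negated if necessary to have a positive entry that limits it.\<close>

lemma poscone_reduce:
  assumes "finite S" "dependent S" "y \<in> poscone S"
  shows "\<exists>v\<in>S. y \<in> poscone (S - {v})"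
proof -
  obtain l where l: "\<forall>v\<in>S. 0 \<le> l v" "y = (\<Sum>v\<in>S. l v *\<^sub>R v)"
    using assms unfolding poscone_def by blast
  obtain u0 where u0: "\<exists>v\<in>S. u0 v \<noteq> 0" "(\<Sum>v\<in>S. u0 v *\<^sub>R v) = 0"
    using assms(1,2) real_vector.dependent_finite by blast
  obtain u where u: "\<exists>v\<in>S. u v > 0" "(\<Sum>v\<in>S. u v *\<^sub>R v) = 0"
  proof (cases "\<exists>v\<in>S. u0 v > 0")
    case True
    with u0 that show ?thesis by blast
  next
    case False
    with u0 that[of "\<lambda>v. - u0 v"] show ?thesis by (force simp: sum_negf)
  qed
  define S' where "S' = {v\<in>S. u v > 0}"
  have S': "finite S'" "S' \<noteq> {}" using u assms by (auto simp: S'_def)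
  obtain v0 where v0: "v0 \<in> S'" "\<And>v. v \<in> S' \<Longrightarrow> l v0 / u v0 \<le> l v / u v"
    using ex_is_arg_min_if_finite[OF S', of "\<lambda>v. l v / u v"]
    by (auto simp: is_arg_min_linorder)
  define t where "t = l v0 / u v0"
  have t0: "0 \<le> t" using v0(1) l by (auto simp: t_def S'_def)
  have nn: "0 \<le> l v - t * u v" if "v \<in> S" for v
  proof (cases "u v > 0")
    case True
    then have "t \<le> l v / u v" using v0(2)[of v] that by (auto simp: S'_def t_def)
    with True show ?thesis by (simp add: field_simps)
  next
    case False
    then have "t * u v \<le> 0" using t0 by (simp add: mult_nonneg_nonpos)
    moreover have "0 \<le> l v" using l(1) that by blast
    ultimately show ?thesis by linarith
  qed
  have "(\<Sum>v\<in>S. (l v - t * u v) *\<^sub>R v) = y - t *\<^sub>R (\<Sum>v\<in>S. u v *\<^sub>R v)"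
    by (simp add: l(2) scaleR_diff_left sum_subtractf scaleR_sum_right)
  also have "\<dots> = y" using u by simp
  finally have y: "y = (\<Sum>v\<in>S. (l v - t * u v) *\<^sub>R v)" ..
  also have "\<dots> = (\<Sum>v\<in>S - {v0}. (l v - t * u v) *\<^sub>R v)"
    using v0(1) assms(1) by (intro sum.mono_neutral_right) (auto simp: t_def S'_def)
  finally have "y \<in> poscone (S - {v0})" using nn unfolding poscone_def
    by (intro CollectI exI[of _ "\<lambda>v. l v - t * u v"]) auto
  with v0(1) show ?thesis by (auto simp: S'_def)
qed

lemma conic_caratheodory:
  assumes "finite V" "y \<in> poscone V"
  shows "\<exists>B\<in>bases V. y \<in> poscone B"
proof -
  let ?F = "{S. S \<subseteq> V \<and> y \<in> poscone S}"
  have "finite ?F" "?F \<noteq> {}" using assms by auto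
  then obtain S where S: "S \<in> ?F" "\<And>T. T \<in> ?F \<Longrightarrow> card S \<le> card T"
    using ex_is_arg_min_if_finite[of ?F card] by (auto simp: is_arg_min_linorder)
  have fS: "finite S" using S(1) assms finite_subset by auto
  have "independent S"
  proof
    assume "dependent S"
    then obtain v where v: "v \<in> S" "y \<in> poscone (S - {v})"
      using poscone_reduce[OF fS] S(1) by blast
    then have "card S \<le> card (S - {v})" using S by (intro S(2)) auto
    then show False using v(1) fS by (metis card_Diff1_less leD)
  qed
  then obtain B where B: "S \<subseteq> B" "B \<subseteq> V" "independent B" "V \<subseteq> span B"
    using maximal_independent_subset_extend[of S V] S(1) by auto
  have "y \<in> poscone B"
    using poscone_mono[OF finite_subset[OF B(2) assms(1)] B(1)] S(1) by auto
  with B show ?thesis by (auto simp: bases_def)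
qed

lemma poscone_basis_iff:
  assumes "independent B" "finite B" "x \<in> span B"
  shows "x \<in> poscone B \<longleftrightarrow> (\<forall>b\<in>B. 0 \<le> coord B b x)"
proof
  assume "x \<in> poscone B"
  then obtain l where "\<forall>v\<in>B. 0 \<le> l v" "x = (\<Sum>v\<in>B. l v *\<^sub>R v)"
    unfolding poscone_def by blast
  then show "\<forall>b\<in>B. 0 \<le> coord B b x" by (simp add: coord_sum assms)
next
  assume "\<forall>b\<in>B. 0 \<le> coord B b x"
  then show "x \<in> poscone B" unfolding poscone_def
    by (intro CollectI exI[of _ "\<lambda>b. coord B b x"]) (simp add: coord_expand assms)
qed

section \<open>Uniqueness and existence of optimal bases\<close>

text \<open>Weak duality. If \<open>B\<close> and \<open>B'\<close> differ, equal cardinality gives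
  \<open>B'\<close> a vector outside \<open>B\<close>, where the \<open>B\<close>-price is strictly
  below cost; as \<open>y\<close> uses this vector with positive weight, its \<open>B\<close>-price
  is smaller than its \<open>B'\<close>-price. By symmetry the reverse would hold too.\<close>

lemma opt_basis_unique:
  assumes V: "finite V" and B: "B \<in> opt_bases V w" "B' \<in> opt_bases V w"
    and y: "y \<in> span V" "\<forall>b\<in>B. 0 < coord B b y" "\<forall>b\<in>B'. 0 < coord B' b y"
  shows "B = B'"
proof -
  have less: "price B w y < price B' w y"
    if "B \<in> opt_bases V w" "B' \<in> opt_bases V w" "B \<noteq> B'" "\<forall>b\<in>B'. 0 < coord B' b y" for B B'
  proof -
    note C = basesD[OF opt_basesD(1)[OF that(1)]] and D = basesD[OF opt_basesD(1)[OF that(2)]]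
    have fin: "finite B" "finite B'" using V C(1) D(1) finite_subset by auto
    have "\<not> B' \<subseteq> B"
    proof
      assume "B' \<subseteq> B"
      moreover have "card B' = card B"
        using basis_card_eq_dim[of B V] basis_card_eq_dim[of B' V] opt_basesD(1)[OF that(1)]
          opt_basesD(1)[OF that(2)] by (auto simp: bases_def)
      ultimately show False using that(3) fin card_subset_eq by metis
    qed
    then obtain c where c: "c \<in> B'" "c \<notin> B" by blast
    have le: "price B w b \<le> w b" if "b \<in> B'" for b
      using opt_basesD(2)[OF \<open>B \<in> _\<close>, of b] price_basis[OF C(2), of b w] D(1) that
      by (cases "b \<in> B") force+
    have "price B w y = price B w (\<Sum>b\<in>B'. coord B' b y *\<^sub>R b)"
      using coord_expand[OF D(2) fin(2)] D(3) y(1) by simp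
    also have "\<dots> = (\<Sum>b\<in>B'. coord B' b y * price B w b)" by (rule price_sum[OF C(2)])
    also have "\<dots> < (\<Sum>b\<in>B'. coord B' b y * w b)"
    proof (rule sum_strict_mono_ex1[OF fin(2)])
      show "\<forall>b\<in>B'. coord B' b y * price B w b \<le> coord B' b y * w b"
        using le that(4) by (simp add: mult_left_mono)
      show "\<exists>b\<in>B'. coord B' b y * price B w b < coord B' b y * w b"
        using c that(4) opt_basesD(2)[OF that(1), of c] D(1) by (intro bexI[of _ c]) auto
    qed
    also have "\<dots> = price B' w y" using price_coord[OF D(2) fin(2)] D(3) y(1) by simp
    finally show ?thesis .
  qed
  show ?thesis using less[OF B] less[OF B(2,1)] y by fastforce
qed

text \<open>Dual nondegeneracy: no reduced cost vanishes. Positive costs keep the minimization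
  bounded.\<close>

definition generic_cost :: "'a::real_vector set \<Rightarrow> ('a \<Rightarrow> real) \<Rightarrow> bool" where
  "generic_cost V w \<longleftrightarrow> (\<forall>v\<in>V. 0 < w v) \<and> (\<forall>B\<in>bases V. \<forall>v\<in>V - B. price B w v \<noteq> w v)"

text \<open>Primal nondegeneracy: the point avoids every hyperplane of \<open>span V\<close> spanned
  by a basis with one vector removed.\<close>

definition generic_dir :: "'a::real_vector set \<Rightarrow> 'a \<Rightarrow> bool" where
  "generic_dir V p \<longleftrightarrow> p \<in> span V \<and> (\<forall>B\<in>bases V. \<forall>b\<in>B. coord B b p \<noteq> 0)"

text \<open>A step of the simplex method: \<open>v\<close> enters, and the ratio test selects the
  vector \<open>b0\<close> that leaves. The price at \<open>y\<close> drops by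
  \<open>t * (price B w v - w v)\<close>.\<close>

lemma pivot:
  assumes V: "finite V" and w: "generic_cost V w" and y: "generic_dir V y"
    and B: "B \<in> bases V" "\<forall>b\<in>B. 0 < coord B b y"
    and v: "v \<in> V" "v \<notin> B" "w v < price B w v"
  shows "\<exists>B'\<in>bases V. (\<forall>b\<in>B'. 0 < coord B' b y) \<and> price B' w y < price B w y"
proof -
  note D = basesD[OF B(1)]
  have fin: "finite B" using V D(1) finite_subset by auto
  have ysp: "y \<in> span B" using y D(3) by (simp add: generic_dir_def)
  have vsp: "v \<in> span B" using v D(3) by (simp add: span_base)
  define c where "c b = coord B b v" for b
  define l where "l b = coord B b y" for b
  have wpos: "0 < w v" if "v \<in> V" for v using w that by (auto simp: generic_cost_def)
  \<comment> \<open>Otherwise the price of \<open>v\<close> is at most 0, yet it exceeds the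
    positive cost \<open>w v\<close>. This is the boundedness of the program.\<close>
  have "\<exists>b\<in>B. c b > 0"
  proof (rule ccontr)
    assume "\<not> ?thesis"
    then have "(\<Sum>b\<in>B. c b * w b) \<le> 0"
      using wpos D(1) by (intro sum_nonpos mult_nonpos_nonneg) force+
    then show False using v wpos[of v] price_coord[OF D(2) fin vsp, of w] by (simp add: c_def)
  qed
  then have S: "finite {b\<in>B. c b > 0}" "{b\<in>B. c b > 0} \<noteq> {}" using fin by auto
  obtain b0 where b0: "b0 \<in> B" "c b0 > 0" "\<And>b. b \<in> B \<Longrightarrow> c b > 0 \<Longrightarrow> l b0 / c b0 \<le> l b / c b"
    using ex_is_arg_min_if_finite[OF S, of "\<lambda>b. l b / c b"]
    by (auto simp: is_arg_min_linorder)
  define t where "t = l b0 / c b0"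
  have t0: "0 < t" using b0 B(2) by (simp add: t_def l_def)
  have nn: "0 \<le> l b - t * c b" if "b \<in> B" for b
  proof (cases "c b > 0")
    case True
    then have "t \<le> l b / c b" using b0(3)[of b] that by (auto simp: t_def)
    with True show ?thesis by (simp add: field_simps)
  next
    case False
    then have "t * c b \<le> 0" using t0 by (simp add: mult_nonneg_nonpos)
    moreover have "0 < l b" using B(2) that by (simp add: l_def)
    ultimately show ?thesis by linarith
  qed
  have z0: "l b0 - t * c b0 = 0" using b0(2) by (simp add: t_def)
  define B' where "B' = insert v (B - {b0})"
  have vB: "v = (\<Sum>b\<in>B. c b *\<^sub>R b)" using coord_expand[OF D(2) fin vsp] by (simp add: c_def)
  have "v \<notin> span (B - {b0})"
  proof
    assume "v \<in> span (B - {b0})"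
    then have "coord B b0 v = 0"
      by (rule linear_eq_0_on_span[OF linear_coord[OF D(2)], rotated])
         (auto simp: coord_basis[OF D(2)])
    then show False using b0 by (simp add: c_def)
  qed
  moreover have "independent (B - {b0})" using D(2) independent_mono by blast
  ultimately have ind: "independent B'" unfolding B'_def by (rule independent_insertI)
  have fin': "finite B'" using fin by (simp add: B'_def)
  have "b0 \<in> span B'"
    using real_vector.in_span_insert[of v b0 "B - {b0}"] \<open>v \<notin> span (B - {b0})\<close> vsp b0(1)
    by (simp add: B'_def insert_absorb)
  then have "B \<subseteq> span B'" by (auto simp: B'_def intro: span_base)
  then have "V \<subseteq> span B'" using D(3) by (metis span_minimal span_superset subspace_span subset_trans)
  then have B'b: "B' \<in> bases V" using ind D(1) v by (auto simp: bases_def B'_def)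
  define m where "m b = (if b = v then t else l b - t * c b)" for b
  have sumB': "(\<Sum>b\<in>B'. f b) = f v + (\<Sum>b\<in>B - {b0}. f b)" for f :: "'a \<Rightarrow> 'x::comm_monoid_add"
    unfolding B'_def using fin v by (subst sum.insert) auto
  have mB: "m b = l b - t * c b" if "b \<in> B - {b0}" for b using that v by (auto simp: m_def)
  have mv: "m v = t" by (simp add: m_def)
  have "(\<Sum>b\<in>B'. m b *\<^sub>R b) = t *\<^sub>R v + (\<Sum>b\<in>B - {b0}. (l b - t * c b) *\<^sub>R b)"
    by (simp add: sumB' mv mB)
  also have "(\<Sum>b\<in>B - {b0}. (l b - t * c b) *\<^sub>R b) = (\<Sum>b\<in>B. (l b - t * c b) *\<^sub>R b)"
    using z0 fin by (intro sum.mono_neutral_left) auto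
  also have "\<dots> = (\<Sum>b\<in>B. l b *\<^sub>R b) - t *\<^sub>R (\<Sum>b\<in>B. c b *\<^sub>R b)"
    by (simp add: scaleR_diff_left sum_subtractf scaleR_sum_right)
  also have "(\<Sum>b\<in>B. l b *\<^sub>R b) = y" using coord_expand[OF D(2) fin ysp] by (simp add: l_def)
  finally have yB': "(\<Sum>b\<in>B'. m b *\<^sub>R b) = y" using vB by simp
  have cB': "coord B' b y = m b" if "b \<in> B'" for b
    using coord_sum[OF ind fin' that, of m] by (simp add: yB')
  have pos: "0 < coord B' b y" if "b \<in> B'" for b
  proof -
    have "0 \<le> m b" using nn t0 that by (auto simp: m_def B'_def)
    \<comment> \<open>The ratio test alone gives nonnegative coordinates; genericity of
      \<open>y\<close> excludes ties, so that the new basis is again strictly feasible.\<close>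
    moreover have "coord B' b y \<noteq> 0" using y B'b that by (auto simp: generic_dir_def)
    ultimately show ?thesis using cB'[OF that] by simp
  qed
  have "price B' w y = (\<Sum>b\<in>B'. m b * w b)"
    using price_coord[OF ind fin', of y w] B'b y cB' basesD(3)[OF B'b]
    by (simp add: generic_dir_def)
  also have "\<dots> = t * w v + (\<Sum>b\<in>B - {b0}. (l b - t * c b) * w b)"
    by (simp add: sumB' mv mB)
  also have "(\<Sum>b\<in>B - {b0}. (l b - t * c b) * w b) = (\<Sum>b\<in>B. (l b - t * c b) * w b)"
    using z0 fin by (intro sum.mono_neutral_left) auto
  also have "\<dots> = (\<Sum>b\<in>B. l b * w b) - t * (\<Sum>b\<in>B. c b * w b)"
    by (simp add: left_diff_distrib sum_subtractf sum_distrib_left mult.assoc)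
  also have "\<dots> = price B w y - t * price B w v"
    using price_coord[OF D(2) fin ysp, of w] price_coord[OF D(2) fin vsp, of w]
    by (simp add: l_def c_def)
  finally have "price B' w y = price B w y - t * (price B w v - w v)" by (simp add: algebra_simps)
  then have "price B' w y < price B w y" using t0 v by simp
  with pos B'b show ?thesis by blast
qed

text \<open>Caratheodory yields a feasible basis, strictly feasible because \<open>y\<close> is
  generic. Among the finitely many of these, one of least price at \<open>y\<close> admits no
  further pivot.\<close>

lemma opt_basis_exists:
  assumes V: "finite V" and w: "generic_cost V w" and y: "generic_dir V y" "y \<in> poscone V"
  shows "\<exists>B\<in>opt_bases V w. \<forall>b\<in>B. 0 < coord B b y"
proof -
  let ?F = "{B \<in> bases V. \<forall>b\<in>B. 0 < coord B b y}"
  have finF: "finite ?F" using finite_bases[OF V] by auto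
  obtain B0 where B0: "B0 \<in> bases V" "y \<in> poscone B0" using conic_caratheodory[OF V y(2)] by blast
  note D = basesD[OF B0(1)]
  have "\<forall>b\<in>B0. 0 \<le> coord B0 b y"
    using poscone_basis_iff[of B0 y] B0(2) D V finite_subset poscone_span by metis
  then have "B0 \<in> ?F" using B0(1) y(1) by (force simp: generic_dir_def)
  then have "?F \<noteq> {}" by blast
  then obtain B where B: "B \<in> ?F" "\<And>B'. B' \<in> ?F \<Longrightarrow> price B w y \<le> price B' w y"
    using ex_is_arg_min_if_finite[OF finF, of "\<lambda>B. price B w y"]
    by (force simp: is_arg_min_linorder)
  have "price B w v < w v" if v: "v \<in> V" "v \<notin> B" for v
  proof (rule ccontr)
    assume "\<not> ?thesis"
    moreover have "price B w v \<noteq> w v" using w B(1) v by (auto simp: generic_cost_def)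
    ultimately have "w v < price B w v" by simp
    then obtain B' where "B' \<in> ?F" "price B' w y < price B w y"
      using pivot[OF V w y(1), of B v] B(1) v by blast
    then show False using B(2) by force
  qed
  then show ?thesis using B(1) by (auto simp: opt_bases_def)
qed

section \<open>Generic costs and directions from polynomial perturbation\<close>

lemma eventually_poly_nonzero:
  fixes Q :: "real poly"
  assumes "Q \<noteq> 0"
  shows "\<forall>\<^sub>F t in at_right a. poly Q t \<noteq> 0"
proof -
  have "\<not> a islimpt {x. poly Q x = 0}"
    using poly_roots_finite[OF assms] by (simp add: islimpt_finite)
  then have "\<forall>\<^sub>F t in at a. poly Q t \<noteq> 0" by (simp add: islimpt_iff_eventually)
  then show ?thesis using at_le[of "{a<..}" UNIV a] by (auto elim: filter_leD)
qed

text \<open>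
  The costs are small perturbations of the constant cost 1, so that optimal bases are also
  weakly optimal for the constant cost.
\<close>

lemma generic_cost_exists:
  fixes V :: "'a::real_vector set"
  assumes V: "finite V"
  shows "\<exists>w. generic_cost V w \<and> (\<forall>B\<in>opt_bases V w. \<forall>v\<in>V. price B (\<lambda>_. 1) v \<le> 1)"
proof -
  obtain i :: "'a \<Rightarrow> nat" where i: "inj_on i V" using finite_imp_inj_to_nat_seg[OF V] by blast
  define w where "w t v = 1 + t ^ Suc (i v)" for t :: real and v
  define good where "good t B v \<longleftrightarrow> (v \<notin> B \<longrightarrow> price B (w t) v \<noteq> w t v \<and>
     (1 < price B (\<lambda>_. 1) v \<longrightarrow> w t v < price B (w t) v))" for t B v
  have good: "\<forall>\<^sub>F t in at_right 0. good t B v" if B: "B \<in> bases V" and v: "v \<in> V" for B v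
  proof (cases "v \<in> B")
    case True
    then show ?thesis by (simp add: good_def)
  next
    case False
    note D = basesD[OF B]
    have fin: "finite B" using V D(1) finite_subset by auto
    have vsp: "v \<in> span B" using D(3) v by (simp add: span_base)
    \<comment> \<open>The reduced cost of \<open>v\<close> as a polynomial in \<open>t\<close>.
      Exponents are distinct and \<open>v\<close> is not in \<open>B\<close>, so the coefficient at
      \<open>Suc (i v)\<close> is 1. All exponents being positive, the constant term is the reduced
      cost for constant costs and, if negative, decides the sign for small \<open>t\<close>.\<close>
    define Q where "Q = [:1 - price B (\<lambda>_. 1) v:] + monom 1 (Suc (i v))
        - (\<Sum>b\<in>B. monom (coord B b v) (Suc (i b)))"
    have Q: "poly Q t = w t v - price B (w t) v" for t
      by (simp add: Q_def w_def poly_sum poly_monom price_coord[OF D(2) fin vsp]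
          sum.distrib distrib_left)
    have "coeff Q (Suc (i v)) = 1 - (\<Sum>b\<in>B. if i b = i v then coord B b v else 0)"
      by (simp add: Q_def coeff_sum)
    also have "(\<Sum>b\<in>B. if i b = i v then coord B b v else 0) = 0"
      using i D(1) v False by (intro sum.neutral) (auto simp: inj_on_def)
    finally have "Q \<noteq> 0" by auto
    from eventually_poly_nonzero[OF this]
    have ne: "\<forall>\<^sub>F t in at_right 0. price B (w t) v \<noteq> w t v"
      by (rule eventually_mono) (simp add: Q)
    have "\<forall>\<^sub>F t in at_right 0. 1 < price B (\<lambda>_. 1) v \<longrightarrow> w t v < price B (w t) v"
    proof (cases "1 < price B (\<lambda>_. 1) v")
      case True
      have "((\<lambda>t. poly Q t) \<longlongrightarrow> poly Q 0) (at_right 0)" by (intro tendsto_intros)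
      moreover have "poly Q 0 < 0"
        using True by (simp add: Q_def poly_sum poly_monom)
      ultimately have "\<forall>\<^sub>F t in at_right 0. poly Q t < 0" by (rule order_tendstoD)
      then show ?thesis by (rule eventually_mono) (simp add: Q)
    qed simp
    with ne show ?thesis unfolding good_def by eventually_elim simp
  qed
  have "\<forall>\<^sub>F t in at_right 0. \<forall>B\<in>bases V. \<forall>v\<in>V. good t B v"
    using good V finite_bases[OF V] by (simp add: eventually_ball_finite_distrib)
  moreover have "\<forall>\<^sub>F t in at_right 0. (0::real) < t" by (rule eventually_at_right_less)
  ultimately have "\<forall>\<^sub>F t in at_right 0. 0 < t \<and> (\<forall>B\<in>bases V. \<forall>v\<in>V. good t B v)"
    by eventually_elim simp
  then obtain t where t: "0 < t" "\<forall>B\<in>bases V. \<forall>v\<in>V. good t B v"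
    using eventually_happens'[OF trivial_limit_at_right_real] by blast
  have "generic_cost V (w t)"
    using t by (auto simp: generic_cost_def good_def w_def intro!: add_pos_pos)
  moreover have "price B (\<lambda>_. 1) v \<le> 1" if B: "B \<in> opt_bases V (w t)" and v: "v \<in> V" for B v
  proof (cases "v \<in> B")
    case True
    then show ?thesis using price_basis basesD(2)[OF opt_basesD(1)[OF B]] by fastforce
  next
    case False
    then have "price B (w t) v < w t v" using opt_basesD(2)[OF B v] by simp
    then show ?thesis using t(2) opt_basesD(1)[OF B] v False by (force simp: good_def)
  qed
  ultimately show ?thesis by blast
qed

text \<open>Along the curve with weights \<open>t ^ i v\<close>, the coordinate at \<open>b\<close>
  is a polynomial in \<open>t\<close> whose coefficient at \<open>i b\<close> is
  \<open>coord B b b = 1\<close>, so it vanishes for finitely many \<open>t\<close> only.\<close>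

lemma generic_dir_exists:
  fixes V :: "'a::real_vector set"
  assumes V: "finite V"
  shows "\<exists>l. (\<forall>v\<in>V. 0 < l v) \<and> generic_dir V (\<Sum>v\<in>V. l v *\<^sub>R v)"
proof -
  obtain i :: "'a \<Rightarrow> nat" where i: "inj_on i V" using finite_imp_inj_to_nat_seg[OF V] by blast
  define p where "p t = (\<Sum>v\<in>V. t ^ i v *\<^sub>R v)" for t :: real
  have good: "\<forall>\<^sub>F t in at_right 0. \<forall>b\<in>B. coord B b (p t) \<noteq> 0" if B: "B \<in> bases V" for B
  proof -
    note D = basesD[OF B]
    have fin: "finite B" using V D(1) finite_subset by auto
    have "\<forall>\<^sub>F t in at_right 0. coord B b (p t) \<noteq> 0" if b: "b \<in> B" for b
    proof -
      define Q where "Q = (\<Sum>v\<in>V. monom (coord B b v) (i v))"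
      have Q: "poly Q t = coord B b (p t)" for t
        using linear_coord[OF D(2), of b]
        by (simp add: Q_def p_def poly_sum poly_monom linear_sum linear_cmul mult.commute)
      have "coeff Q (i b) = (\<Sum>v\<in>V. if v = b then coord B b v else 0)"
        unfolding Q_def coeff_sum using i b D(1) by (intro sum.cong) (auto simp: inj_on_def)
      also have "\<dots> = 1" using V b D(1) by (auto simp: coord_basis[OF D(2)])
      finally have "Q \<noteq> 0" by auto
      from eventually_poly_nonzero[OF this] show ?thesis by (simp add: Q)
    qed
    then show ?thesis using fin by (simp add: eventually_ball_finite_distrib)
  qed
  then have "\<forall>\<^sub>F t in at_right 0. \<forall>B\<in>bases V. \<forall>b\<in>B. coord B b (p t) \<noteq> 0"
    using finite_bases[OF V] by (simp add: eventually_ball_finite_distrib)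
  moreover have "\<forall>\<^sub>F t in at_right 0. (0::real) < t" by (rule eventually_at_right_less)
  ultimately have "\<forall>\<^sub>F t in at_right 0. 0 < t \<and> (\<forall>B\<in>bases V. \<forall>b\<in>B. coord B b (p t) \<noteq> 0)"
    by eventually_elim simp
  then obtain t where t: "0 < t" "\<forall>B\<in>bases V. \<forall>b\<in>B. coord B b (p t) \<noteq> 0"
    using eventually_happens'[OF trivial_limit_at_right_real] by blast
  have "p t \<in> span V" by (auto simp: p_def intro: span_sum span_scale span_base)
  with t have "generic_dir V (\<Sum>v\<in>V. (t ^ i v) *\<^sub>R v)" by (simp add: generic_dir_def p_def)
  with t(1) show ?thesis by (intro exI[of _ "\<lambda>v. t ^ i v"]) simp
qed

lemma generic_dir_scale:
  assumes "generic_dir V p" "c \<noteq> 0"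
  shows "generic_dir V (c *\<^sub>R p)"
  using assms by (auto simp: generic_dir_def span_scale linear_cmul[OF linear_coord] basesD(2))

section \<open>Half-open decompositions\<close>

text \<open>When no coordinate of \<open>p\<close> vanishes, these are the \<open>x\<close> for
  which \<open>x + r *\<^sub>R p\<close> has positive coordinates for all small
  \<open>r > 0\<close>.\<close>

definition halfopen :: "'a::real_vector set \<Rightarrow> 'a \<Rightarrow> 'a \<Rightarrow> bool" where
  "halfopen B p x \<longleftrightarrow> (\<forall>b\<in>B. 0 \<le> coord B b x \<and> (coord B b p < 0 \<longrightarrow> 0 < coord B b x))"

lemma eventually_sign_perturb:
  fixes a c :: real
  assumes "c \<noteq> 0"
  shows "\<forall>\<^sub>F r in at_right 0. a + r * c \<noteq> 0 \<and> (0 < a + r * c \<longleftrightarrow> 0 \<le> a \<and> (c < 0 \<longrightarrow> 0 < a))"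
proof (cases "a = 0")
  case True
  have "\<forall>\<^sub>F r in at_right 0. (0::real) < r" by (rule eventually_at_right_less)
  then show ?thesis
    by (rule eventually_mono) (use True assms in \<open>auto simp: zero_less_mult_iff\<close>)
next
  case False
  have lim: "((\<lambda>r. a + r * c) \<longlongrightarrow> a + 0 * c) (at_right 0)" by (intro tendsto_intros)
  show ?thesis
  proof (cases "a > 0")
    case True
    with lim have "\<forall>\<^sub>F r in at_right 0. 0 < a + r * c" by (intro order_tendstoD(1)) auto
    then show ?thesis by (rule eventually_mono) (use True in auto)
  next
    case F: False
    with False lim have "\<forall>\<^sub>F r in at_right 0. a + r * c < 0" by (intro order_tendstoD(2)) auto
    then show ?thesis by (rule eventually_mono) (use F False in auto)
  qed
qed

lemma eventually_generic_perturb: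
  assumes V: "finite V" and p: "generic_dir V p" and x: "x \<in> span V"
  shows "\<forall>\<^sub>F r in at_right 0. generic_dir V (x + r *\<^sub>R p) \<and>
    (\<forall>B\<in>bases V. (\<forall>b\<in>B. 0 < coord B b (x + r *\<^sub>R p)) \<longleftrightarrow> halfopen B p x)"
proof -
  have "\<forall>\<^sub>F r in at_right 0. \<forall>B\<in>bases V. \<forall>b\<in>B. coord B b x + r * coord B b p \<noteq> 0 \<and>
    (0 < coord B b x + r * coord B b p \<longleftrightarrow> 0 \<le> coord B b x \<and> (coord B b p < 0 \<longrightarrow> 0 < coord B b x))"
    using p V finite_bases[OF V] basesD(1)
    by (intro eventually_ball_finite ballI eventually_sign_perturb)
       (auto simp: generic_dir_def intro: finite_subset)
  then show ?thesis
  proof (rule eventually_mono)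
    fix r
    assume r: "\<forall>B\<in>bases V. \<forall>b\<in>B. coord B b x + r * coord B b p \<noteq> 0 \<and>
    (0 < coord B b x + r * coord B b p \<longleftrightarrow> 0 \<le> coord B b x \<and> (coord B b p < 0 \<longrightarrow> 0 < coord B b x))"
    have c: "coord B b (x + r *\<^sub>R p) = coord B b x + r * coord B b p" if "B \<in> bases V" for B b
      using linear_coord[OF basesD(2)[OF that]] by (simp add: linear_add linear_cmul)
    have "x + r *\<^sub>R p \<in> span V" using x p by (simp add: generic_dir_def span_add span_scale)
    with r show "generic_dir V (x + r *\<^sub>R p) \<and>
      (\<forall>B\<in>bases V. (\<forall>b\<in>B. 0 < coord B b (x + r *\<^sub>R p)) \<longleftrightarrow> halfopen B p x)"
      by (simp add: generic_dir_def halfopen_def c)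
  qed
qed

lemma halfopen_unique:
  assumes V: "finite V" and p: "generic_dir V p" and x: "x \<in> span V"
    and B: "B \<in> opt_bases V w" "B' \<in> opt_bases V w" "halfopen B p x" "halfopen B' p x"
  shows "B = B'"
proof -
  obtain r where r: "generic_dir V (x + r *\<^sub>R p)"
    "\<forall>B\<in>bases V. (\<forall>b\<in>B. 0 < coord B b (x + r *\<^sub>R p)) \<longleftrightarrow> halfopen B p x"
    using eventually_happens'[OF trivial_limit_at_right_real eventually_generic_perturb[OF V p x]]
    by blast
  show ?thesis
    using r B opt_basesD(1) by (intro opt_basis_unique[OF V B(1,2)]) (auto simp: generic_dir_def)
qed

text \<open>For small \<open>r\<close> the perturbed point is generic and its signs in the finitely
  many bases are settled, so one value of \<open>r\<close> reduces the claim to the existence of an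
  optimal basis.\<close>

lemma halfopen_iff:
  assumes V: "finite V" and w: "generic_cost V w" and p: "generic_dir V p" and x: "x \<in> span V"
  shows "(\<forall>\<^sub>F r in at_right 0. x + r *\<^sub>R p \<in> poscone V) \<longleftrightarrow> (\<exists>B\<in>opt_bases V w. halfopen B p x)"
proof
  assume "\<forall>\<^sub>F r in at_right 0. x + r *\<^sub>R p \<in> poscone V"
  with eventually_generic_perturb[OF V p x]
  have "\<forall>\<^sub>F r in at_right 0. x + r *\<^sub>R p \<in> poscone V \<and> generic_dir V (x + r *\<^sub>R p) \<and>
    (\<forall>B\<in>bases V. (\<forall>b\<in>B. 0 < coord B b (x + r *\<^sub>R p)) \<longleftrightarrow> halfopen B p x)"
    by eventually_elim simp
  then obtain r where r: "x + r *\<^sub>R p \<in> poscone V" "generic_dir V (x + r *\<^sub>R p)"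
    "\<forall>B\<in>bases V. (\<forall>b\<in>B. 0 < coord B b (x + r *\<^sub>R p)) \<longleftrightarrow> halfopen B p x"
    using eventually_happens'[OF trivial_limit_at_right_real] by blast
  from opt_basis_exists[OF V w r(2,1)] r(3) show "\<exists>B\<in>opt_bases V w. halfopen B p x"
    using opt_basesD(1) by blast
next
  assume "\<exists>B\<in>opt_bases V w. halfopen B p x"
  then obtain B where B: "B \<in> bases V" "halfopen B p x" using opt_basesD(1) by blast
  note D = basesD[OF B(1)]
  show "\<forall>\<^sub>F r in at_right 0. x + r *\<^sub>R p \<in> poscone V"
  proof (rule eventually_mono[OF eventually_generic_perturb[OF V p x]])
    fix r
    assume r: "generic_dir V (x + r *\<^sub>R p) \<and>
      (\<forall>B\<in>bases V. (\<forall>b\<in>B. 0 < coord B b (x + r *\<^sub>R p)) \<longleftrightarrow> halfopen B p x)"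
    then have "\<forall>b\<in>B. 0 < coord B b (x + r *\<^sub>R p)" "x + r *\<^sub>R p \<in> span B"
      using B D(3) by (simp_all add: generic_dir_def)
    then have "x + r *\<^sub>R p \<in> poscone B"
      using poscone_basis_iff[OF D(2) finite_subset[OF D(1) V]] by (simp add: less_imp_le)
    then show "x + r *\<^sub>R p \<in> poscone V" using poscone_mono[OF V D(1)] by blast
  qed
qed

lemma halfopen_imp_poscone:
  assumes V: "finite V" and B: "B \<in> bases V" and x: "x \<in> span V" and "halfopen B p x"
  shows "x \<in> poscone B" "x \<in> poscone V"
proof -
  note D = basesD[OF B]
  show "x \<in> poscone B"
    using poscone_basis_iff[OF D(2) finite_subset[OF D(1) V]] assms(3,4) D(3)
    by (auto simp: halfopen_def)
  then show "x \<in> poscone V" using poscone_mono[OF V D(1)] by blast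
qed

section \<open>Lattice points in half-open simplicial cones\<close>

text \<open>
  A simplicial cone is given by its generators \<open>e i\<close> and a dual system of coordinates \<open>c i\<close>.
  In \<open>points J A n\<close> the coordinates in \<open>J\<close> are positive, the others nonnegative, and those outside
  \<open>A\<close> are moreover confined to the half-open unit interval; thus \<open>A = I\<close> gives the whole half-open
  cone and \<open>A = {}\<close> its fundamental box.
\<close>

locale lattice_cone =
  fixes I :: "'i set" and e :: "'i \<Rightarrow> 'a::real_vector" and c :: "'i \<Rightarrow> 'a \<Rightarrow> real"
    and L :: "'a set" and ht :: "'a \<Rightarrow> real"
  assumes fin_I: "finite I"
    and linear_c: "i \<in> I \<Longrightarrow> linear (c i)"
    and dual: "i \<in> I \<Longrightarrow> j \<in> I \<Longrightarrow> c i (e j) = (if i = j then 1 else 0)"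
    and e_L: "i \<in> I \<Longrightarrow> e i \<in> L"
    and L_add: "x \<in> L \<Longrightarrow> y \<in> L \<Longrightarrow> x + y \<in> L"
    and L_diff: "x \<in> L \<Longrightarrow> y \<in> L \<Longrightarrow> x - y \<in> L"
    and linear_ht: "linear ht"
    and ht_e: "i \<in> I \<Longrightarrow> ht (e i) = 1"
    and fin: "finite {x\<in>L. x = (\<Sum>i\<in>I. c i x *\<^sub>R e i) \<and> (\<forall>i\<in>I. 0 \<le> c i x) \<and> ht x = real n}"
begin

text \<open>A genuine restriction when the \<open>e i\<close> do not span the space: the pieces of
  the boundary have one generator fewer than the dimension.\<close>

definition expands :: "'a \<Rightarrow> bool" where
  "expands x \<longleftrightarrow> x = (\<Sum>i\<in>I. c i x *\<^sub>R e i)"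

definition low :: "'i set \<Rightarrow> 'i \<Rightarrow> 'a \<Rightarrow> bool" where
  "low J i x \<longleftrightarrow> 0 \<le> c i x \<and> (i \<in> J \<longrightarrow> 0 < c i x)"

text \<open>Complementary to \<open>low\<close>: of the two values 0 and 1 exactly one is kept, so
  that translates of the box tile the half-open cone.\<close>

definition upp :: "'i set \<Rightarrow> 'i \<Rightarrow> 'a \<Rightarrow> bool" where
  "upp J i x \<longleftrightarrow> c i x \<le> 1 \<and> (i \<notin> J \<longrightarrow> c i x < 1)"

definition points :: "'i set \<Rightarrow> 'i set \<Rightarrow> nat \<Rightarrow> 'a set" where
  "points J A n = {x\<in>L. expands x \<and> ht x = real n \<and>
     (\<forall>i\<in>I. low J i x) \<and> (\<forall>i\<in>I - A. upp J i x)}"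

definition gf :: "'i set \<Rightarrow> 'i set \<Rightarrow> real fps" where
  "gf J A = Abs_fps (\<lambda>n. real (card (points J A n)))"

lemma finite_points: "finite (points J A n)"
  by (rule finite_subset[OF _ fin[of n]]) (auto simp: points_def low_def expands_def)

lemma ht_sum:
  assumes "expands x"
  shows "ht x = (\<Sum>i\<in>I. c i x)"
proof -
  have "ht (\<Sum>i\<in>I. c i x *\<^sub>R e i) = (\<Sum>i\<in>I. c i x)"
    using linear_ht by (simp add: linear_sum linear_cmul ht_e)
  with assms show ?thesis by (simp add: expands_def)
qed

lemma c_add_e:
  assumes "i \<in> I" "a \<in> I"
  shows "c i (x + e a) = c i x + (if i = a then 1 else 0)"
    and "c i (x - e a) = c i x - (if i = a then 1 else 0)"
  using assms by (simp_all add: linear_add[OF linear_c] linear_diff[OF linear_c] dual)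

lemma expansion_add_e:
  assumes "a \<in> I" "expands x"
  shows "expands (x + e a)" "expands (x - e a)"
proof -
  have s: "(\<Sum>i\<in>I. (if i = a then 1 else 0) *\<^sub>R e i) = e a"
    using assms(1) fin_I by (simp add: if_distrib[of "\<lambda>t. t *\<^sub>R _"] cong: if_cong)
  have "(\<Sum>i\<in>I. c i (x + e a) *\<^sub>R e i) = (\<Sum>i\<in>I. c i x *\<^sub>R e i) + (\<Sum>i\<in>I. (if i = a then 1 else 0) *\<^sub>R e i)"
    using assms(1) by (simp only: sum.distrib[symmetric] scaleR_add_left[symmetric])
      (intro sum.cong; simp add: c_add_e)
  then show "expands (x + e a)" using assms(2) s by (simp add: expands_def)
  have "(\<Sum>i\<in>I. c i (x - e a) *\<^sub>R e i) = (\<Sum>i\<in>I. c i x *\<^sub>R e i) - (\<Sum>i\<in>I. (if i = a then 1 else 0) *\<^sub>R e i)"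
    using assms(1) by (simp only: sum_subtractf[symmetric] scaleR_diff_left[symmetric])
      (intro sum.cong; simp add: c_add_e)
  then show "expands (x - e a)" using assms(2) s by (simp add: expands_def)
qed

text \<open>A point whose coordinate at \<open>a\<close> exceeds its unit interval is the shift by
  \<open>e a\<close>, a vector of height 1, of a unique point of the same set one level
  lower.\<close>

lemma card_points_insert:
  assumes a: "a \<in> I" "a \<notin> A"
  shows "card (points J (insert a A) n) =
    card (points J A n) + (if n = 0 then 0 else card (points J (insert a A) (n - 1)))"
proof -
  let ?P = "points J (insert a A)"
  have eq: "?P n = points J A n \<union> {x \<in> ?P n. \<not> upp J a x}"
    using a by (auto simp: points_def)
  have disj: "points J A n \<inter> {x \<in> ?P n. \<not> upp J a x} = {}" using a by (auto simp: points_def)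
  have "card {x \<in> ?P n. \<not> upp J a x} = (if n = 0 then 0 else card (?P (n - 1)))"
  \<comment> \<open>Level 0 has no level below, and subtraction is truncated; there all coordinates
    vanish, so no point exceeds the box.\<close>
  proof (cases "n = 0")
    case True
    have "upp J a x" if "x \<in> ?P n" for x
    proof -
      have "(\<Sum>i\<in>I. c i x) = 0" "\<forall>i\<in>I. 0 \<le> c i x"
        using that True ht_sum[of x] by (auto simp: points_def low_def)
      then have "c a x = 0" using a(1) fin_I by (simp add: sum_nonneg_eq_0_iff)
      then show ?thesis by (simp add: upp_def)
    qed
    then have "{x \<in> ?P n. \<not> upp J a x} = {}" by blast
    then show ?thesis using True by (simp only: card.empty if_True simp_thms)
  next
    case False
    have "bij_betw (\<lambda>x. x + e a) (?P (n - 1)) {x \<in> ?P n. \<not> upp J a x}"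
    proof (rule bij_betwI[where g = "\<lambda>x. x - e a"])
      show "(\<lambda>x. x + e a) \<in> ?P (n - 1) \<rightarrow> {x \<in> ?P n. \<not> upp J a x}"
      proof
        fix x assume x: "x \<in> ?P (n - 1)"
        then have "expands (x + e a)"
          by (intro expansion_add_e(1) a) (simp add: points_def)
        then show "x + e a \<in> {x \<in> ?P n. \<not> upp J a x}"
          using x a False
          by (auto simp: points_def low_def upp_def c_add_e L_add e_L ht_e linear_add[OF linear_ht]
              of_nat_diff)
      qed
      show "(\<lambda>x. x - e a) \<in> {x \<in> ?P n. \<not> upp J a x} \<rightarrow> ?P (n - 1)"
      proof
        fix x assume x: "x \<in> {x \<in> ?P n. \<not> upp J a x}"
        then have "expands (x - e a)"
          by (intro expansion_add_e(2) a) (simp add: points_def)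
        then show "x - e a \<in> ?P (n - 1)"
          using x a False
          by (auto simp: points_def low_def upp_def c_add_e L_diff e_L ht_e linear_diff[OF linear_ht]
              of_nat_diff)
      qed
    qed auto
    then show ?thesis using False by (simp add: bij_betw_same_card)
  qed
  moreover have "card (?P n) = card (points J A n) + card {x \<in> ?P n. \<not> upp J a x}"
    by (subst eq) (rule card_Un_disjoint, auto simp: finite_points disj)
  ultimately show ?thesis by simp
qed

lemma gf_insert:
  assumes "a \<in> I" "a \<notin> A"
  shows "(1 - fps_X) * gf J (insert a A) = gf J A"
proof (rule fps_ext)
  fix n
  show "fps_nth ((1 - fps_X) * gf J (insert a A)) n = fps_nth (gf J A) n"
    using card_points_insert[OF assms, of J n]
    by (simp add: gf_def left_diff_distrib)
qed

lemma gf_cone: "(1 - fps_X) ^ card I * gf J I = gf J {}"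
proof -
  have "(1 - fps_X) ^ card A * gf J A = gf J {}" if "A \<subseteq> I" for A
    using finite_subset[OF that fin_I] that
  proof (induction A rule: finite_induct)
    case (insert a A)
    then have "(1 - fps_X) ^ card (insert a A) * gf J (insert a A)
        = (1 - fps_X) ^ card A * ((1 - fps_X) * gf J (insert a A))"
      by (simp add: mult_ac)
    also have "\<dots> = gf J {}" using insert gf_insert[of a A J] by simp
    finally show ?case .
  qed simp
  then show ?thesis by simp
qed

lemma ht_box_le:
  assumes "x \<in> points J {} n"
  shows "n \<le> card I"
proof -
  have "real n = (\<Sum>i\<in>I. c i x)" using assms ht_sum[of x] by (simp add: points_def)
  also have "\<dots> \<le> (\<Sum>i\<in>I. 1)" using assms by (intro sum_mono) (simp add: points_def upp_def)
  finally show ?thesis by simp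
qed

text \<open>The point reflection \<open>x \<mapsto> s - x\<close>, with \<open>s\<close> the sum of
  the generators, sends each coordinate \<open>t\<close> to \<open>1 - t\<close>. It therefore
  exchanges the two kinds of half-open interval.\<close>

lemma box_reflect:
  assumes "n \<le> card I"
  shows "card (points (I - J) {} (card I - n)) = card (points J {} n)"
proof -
  define s where "s = (\<Sum>i\<in>I. e i)"
  have s_L: "s - x \<in> L" if "x \<in> L" for x
  proof -
    have "(\<Sum>i\<in>K. e i) - x \<in> L" if "x \<in> L" "K \<subseteq> I" for K
      using finite_subset[OF that(2) fin_I] that
    proof (induction K rule: finite_induct)
      case empty
      have "x - x - x \<in> L" using empty L_diff by blast
      then show ?case by simp
    next
      case (insert k K)
      then show ?case using L_add[of "e k" "sum e K - x"] e_L by (simp add: algebra_simps)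
    qed
    then show ?thesis using that by (simp add: s_def)
  qed
  have cs: "c i (s - x) = 1 - c i x" if "i \<in> I" for i x
  proof -
    have "c i s = (\<Sum>j\<in>I. if i = j then 1 else 0)"
      unfolding s_def linear_sum[OF linear_c[OF that]] using that by (intro sum.cong) (auto simp: dual)
    then show ?thesis using that fin_I by (simp add: linear_diff[OF linear_c])
  qed
  have sx: "expands (s - x)" if "expands x" for x
  proof -
    have "(\<Sum>i\<in>I. c i (s - x) *\<^sub>R e i) = (\<Sum>i\<in>I. e i) - (\<Sum>i\<in>I. c i x *\<^sub>R e i)"
      by (simp add: cs scaleR_diff_left sum_subtractf)
    then show ?thesis using that by (simp add: s_def expands_def)
  qed
  have hs: "ht (s - x) = real (card I) - ht x" for x
    by (simp add: linear_diff[OF linear_ht] s_def linear_sum[OF linear_ht] ht_e)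
  have "bij_betw (\<lambda>x. s - x) (points J {} n) (points (I - J) {} (card I - n))"
  proof (rule bij_betwI[where g = "\<lambda>x. s - x"])
    show "(\<lambda>x. s - x) \<in> points J {} n \<rightarrow> points (I - J) {} (card I - n)"
    proof
      fix x assume x: "x \<in> points J {} n"
      then have "expands (s - x)" by (intro sx) (simp add: points_def)
      then show "s - x \<in> points (I - J) {} (card I - n)" using x assms
        by (auto simp: points_def low_def upp_def cs hs s_L of_nat_diff)
    qed
    show "(\<lambda>x. s - x) \<in> points (I - J) {} (card I - n) \<rightarrow> points J {} n"
    proof
      fix x assume x: "x \<in> points (I - J) {} (card I - n)"
      then have "expands (s - x)" by (intro sx) (simp add: points_def)
      then show "s - x \<in> points J {} n" using x assms
        by (auto simp: points_def low_def upp_def cs hs s_L of_nat_diff)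
    qed
  qed auto
  then show ?thesis by (simp add: bij_betw_same_card)
qed

end

section \<open>The cone over a lattice polytope\<close>

lemma poscone_image:
  assumes "linear f" "inj_on f V" "x \<in> poscone V"
  shows "f x \<in> poscone (f ` V)"
proof -
  obtain l where l: "\<forall>v\<in>V. 0 \<le> l v" "x = (\<Sum>v\<in>V. l v *\<^sub>R v)"
    using assms(3) unfolding poscone_def by blast
  have "f x = (\<Sum>v\<in>f ` V. l (the_inv_into V f v) *\<^sub>R v)"
    using assms(1,2) by (simp add: l(2) linear_sum linear_cmul sum.reindex the_inv_into_f_f)
  with l(1) assms(2) show ?thesis unfolding poscone_def
    by (intro CollectI exI[of _ "\<lambda>v. l (the_inv_into V f v)"]) (auto simp: the_inv_into_f_f)
qed

section \<open>Homogenization: the lifted lattice and its slices by height\<close>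

definition lattice1 :: "((real ^ 'n) \<times> real) set" where
  "lattice1 = integer_lattice \<times> \<int>"

definition slice :: "((real ^ 'n) \<times> real) set \<Rightarrow> nat \<Rightarrow> ((real ^ 'n) \<times> real) set" where
  "slice S n = {x \<in> lattice1. x \<in> S \<and> snd x = real n}"

lemma linear_snd: "linear (snd :: 'a::real_vector \<times> 'b::real_vector \<Rightarrow> 'b)"
  by (rule linearI) auto

lemma lattice1_add: "x \<in> lattice1 \<Longrightarrow> y \<in> lattice1 \<Longrightarrow> x + y \<in> lattice1"
  by (auto simp: lattice1_def integer_lattice_def)

lemma lattice1_diff: "x \<in> lattice1 \<Longrightarrow> y \<in> lattice1 \<Longrightarrow> x - y \<in> lattice1"
  by (auto simp: lattice1_def integer_lattice_def)

lemma finite_lattice1_bounded: "finite {x \<in> lattice1 :: ((real ^ 'n) \<times> real) set. norm x \<le> K}"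
proof (rule finite_subset)
  let ?I = "{k\<in>\<int>. \<bar>k\<bar> \<le> K}"
  show "{x \<in> lattice1 :: ((real ^ 'n) \<times> real) set. norm x \<le> K} \<subseteq>
      vec_lambda ` (\<Pi>\<^sub>E i\<in>UNIV. ?I) \<times> ?I"
  proof
    fix x :: "(real ^ 'n) \<times> real" assume x: "x \<in> {x \<in> lattice1. norm x \<le> K}"
    have "\<bar>fst x $ i\<bar> \<le> K" for i
      using x component_le_norm_cart[of "fst x" i] norm_fst_le[of "fst x" "snd x"] by simp
    then have "vec_nth (fst x) \<in> (\<Pi>\<^sub>E i\<in>UNIV. ?I)"
      using x by (auto simp: lattice1_def integer_lattice_def)
    then have "fst x \<in> vec_lambda ` (\<Pi>\<^sub>E i\<in>UNIV. ?I)"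
      by (intro image_eqI[of _ _ "vec_nth (fst x)"]) simp_all
    moreover have "snd x \<in> ?I"
      using x norm_snd_le[of "snd x" "fst x"] by (auto simp: lattice1_def)
    ultimately show "x \<in> vec_lambda ` (\<Pi>\<^sub>E i\<in>UNIV. ?I) \<times> ?I" by (auto simp: mem_Times_iff)
  qed
  show "finite (vec_lambda ` (\<Pi>\<^sub>E i\<in>(UNIV :: 'n set). ?I) \<times> ?I)"
    by (intro finite_cartesian_product finite_imageI finite_PiE finite_abs_int_segment) simp
qed

locale lattice_config =
  fixes V :: "(real ^ 'n) set"
  assumes fin_V: "finite V" and V_lattice: "V \<subseteq> integer_lattice" and aff_V: "affine hull V = UNIV"
begin

definition lift_V :: "((real ^ 'n) \<times> real) set" where
  "lift_V = (\<lambda>v. (v, 1)) ` V"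

abbreviation cone_V :: "((real ^ 'n) \<times> real) set" where
  "cone_V \<equiv> poscone lift_V"

lemma fin_lift: "finite lift_V"
  using fin_V by (simp add: lift_V_def)

lemma snd_lift: "u \<in> lift_V \<Longrightarrow> snd u = 1"
  by (auto simp: lift_V_def)

lemma lift_lattice1: "lift_V \<subseteq> lattice1"
  using V_lattice by (auto simp: lift_V_def lattice1_def)

lemma coneE:
  assumes "x \<in> cone_V"
  obtains l where "\<forall>u\<in>lift_V. 0 \<le> l u" "x = (\<Sum>u\<in>lift_V. l u *\<^sub>R u)" "snd x = (\<Sum>u\<in>lift_V. l u)"
proof -
  obtain l where l: "\<forall>u\<in>lift_V. 0 \<le> l u" "x = (\<Sum>u\<in>lift_V. l u *\<^sub>R u)"
    using assms unfolding poscone_def by blast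
  have "snd x = (\<Sum>u\<in>lift_V. l u)"
    unfolding l(2) linear_sum[OF linear_snd] by (intro sum.cong) (auto simp: snd_lift)
  with l that show ?thesis by blast
qed

lemma snd_cone_nonneg: "x \<in> cone_V \<Longrightarrow> 0 \<le> snd x"
  by (erule coneE) (auto intro: sum_nonneg)

lemma finite_slice: "finite (slice cone_V n)"
proof (rule finite_subset[OF _ finite_lattice1_bounded])
  show "slice cone_V n \<subseteq> {x \<in> lattice1. norm x \<le> real n * (\<Sum>u\<in>lift_V. norm u)}"
  proof
    fix x :: "(real ^ 'n) \<times> real" assume x: "x \<in> slice cone_V n"
    then obtain l where l: "\<forall>u\<in>lift_V. 0 \<le> l u" "x = (\<Sum>u\<in>lift_V. l u *\<^sub>R u)"
        "snd x = (\<Sum>u\<in>lift_V. l u)"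
      by (auto simp: slice_def elim: coneE)
    have "norm x \<le> (\<Sum>u\<in>lift_V. norm (l u *\<^sub>R u))" unfolding l(2) by (rule norm_sum)
    also have "\<dots> \<le> (\<Sum>u\<in>lift_V. real n * norm u)"
    proof (rule sum_mono)
      fix u assume u: "u \<in> lift_V"
      have "l u \<le> (\<Sum>u\<in>lift_V. l u)" using l(1) u fin_lift by (intro member_le_sum) auto
      then show "norm (l u *\<^sub>R u) \<le> real n * norm u"
        using l u x by (auto simp: slice_def intro!: mult_right_mono)
    qed
    finally show "x \<in> {x \<in> lattice1. norm x \<le> real n * (\<Sum>u\<in>lift_V. norm u)}"
      using x by (simp add: slice_def sum_distrib_left)
  qed
qed

lemma slice_0: "slice cone_V 0 = {0}"
proof -
  have "x = 0" if "x \<in> slice cone_V 0" for x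
  proof -
    from that obtain l where l: "\<forall>u\<in>lift_V. 0 \<le> l u" "x = (\<Sum>u\<in>lift_V. l u *\<^sub>R u)"
        "(\<Sum>u\<in>lift_V. l u) = 0"
      by (auto simp: slice_def elim!: coneE)
    then have "\<forall>u\<in>lift_V. l u = 0" using fin_lift by (simp add: sum_nonneg_eq_0_iff)
    then show ?thesis by (simp add: l(2))
  qed
  moreover have "0 \<in> slice cone_V 0"
    using poscone_0[of lift_V] by (simp add: slice_def lattice1_def integer_lattice_def zero_prod_def)
  ultimately show ?thesis by blast
qed

text \<open>All points \<open>(x, 1)\<close> are lifted affine combinations; among them
  \<open>(0, 1)\<close> supplies the remaining direction.\<close>

lemma span_lift: "span lift_V = UNIV"
proof -
  have 1: "(x, 1) \<in> span lift_V" for x :: "real ^ 'n"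
  proof -
    have "x \<in> affine hull V" using aff_V by simp
    then obtain u where u: "sum u V = 1" "(\<Sum>v\<in>V. u v *\<^sub>R v) = x"
      by (auto simp: affine_hull_finite[OF fin_V])
    have "(x, 1::real) = (\<Sum>v\<in>V. u v *\<^sub>R (v, 1))"
      using u by (simp add: prod_eq_iff fst_sum snd_sum)
    also have "\<dots> \<in> span lift_V" by (intro span_sum span_scale span_base) (simp add: lift_V_def)
    finally show ?thesis .
  qed
  have "(x, s) \<in> span lift_V" for x :: "real ^ 'n" and s
  proof -
    have "(x, 1) + (s - 1) *\<^sub>R (0, 1) \<in> span lift_V" by (intro span_add span_scale 1)
    then show ?thesis by simp
  qed
  then show ?thesis by auto
qed

lemma card_basis: "B \<in> bases lift_V \<Longrightarrow> card B = CARD('n) + 1"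
proof -
  assume B: "B \<in> bases lift_V"
  then have "card B = dim lift_V" by (intro basis_card_eq_dim) (auto simp: bases_def)
  also have "\<dots> = dim (UNIV :: ((real ^ 'n) \<times> real) set)" by (metis dim_span span_lift)
  finally show ?thesis by (simp add: dim_UNIV)
qed

section \<open>The numerator of a half-open decomposition and reciprocity\<close>

definition inner_cone :: "(real ^ 'n) \<times> real \<Rightarrow> ((real ^ 'n) \<times> real) set" where
  "inner_cone p = {x. \<forall>\<^sub>F r in at_right 0. x + r *\<^sub>R p \<in> cone_V}"

definition box_card :: "(real ^ 'n) \<times> real \<Rightarrow> ((real ^ 'n) \<times> real) set \<Rightarrow> nat \<Rightarrow> nat" where
  "box_card p B j = card (lattice_cone.points B (\<lambda>b. b) (coord B) lattice1 snd {b\<in>B. coord B b p < 0} {} j)"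

text \<open>This is the h*-vector when \<open>inner_cone p\<close> is the whole cone; for the
  opposite direction it is the numerator of the series of the interior.\<close>

definition hvec :: "((real ^ 'n) \<times> real \<Rightarrow> real) \<Rightarrow> (real ^ 'n) \<times> real \<Rightarrow> nat \<Rightarrow> real" where
  "hvec w p j = (\<Sum>B\<in>opt_bases lift_V w. real (box_card p B j))"

lemma finite_opt: "finite (opt_bases lift_V w)"
  using finite_bases[OF fin_lift] by (rule finite_subset[rotated]) (auto simp: opt_bases_def)

lemma lattice_cone_basis:
  assumes "B \<in> bases lift_V"
  shows "lattice_cone B (\<lambda>b. b) (coord B) lattice1 snd"
proof -
  note D = basesD[OF assms]
  have fB: "finite B" using D(1) fin_lift finite_subset by auto
  show ?thesis
  proof (rule lattice_cone.intro)
    fix n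
    have "{x \<in> lattice1. x = (\<Sum>i\<in>B. coord B i x *\<^sub>R i) \<and> (\<forall>i\<in>B. 0 \<le> coord B i x) \<and> snd x = real n}
        \<subseteq> slice cone_V n"
    proof
      fix x assume x: "x \<in> {x \<in> lattice1. x = (\<Sum>i\<in>B. coord B i x *\<^sub>R i) \<and> (\<forall>i\<in>B. 0 \<le> coord B i x) \<and> snd x = real n}"
      then have "x \<in> poscone B"
        using poscone_basis_iff[OF D(2) fB, of x] D(3) span_lift by simp
      then show "x \<in> slice cone_V n"
        using x poscone_mono[OF fin_lift D(1)] by (auto simp: slice_def)
    qed
    then show "finite {x \<in> lattice1. x = (\<Sum>i\<in>B. coord B i x *\<^sub>R i) \<and> (\<forall>i\<in>B. 0 \<le> coord B i x) \<and> snd x = real n}"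
      using finite_slice finite_subset by blast
  qed (use D fB snd_lift lift_lattice1 in
        \<open>simp_all add: linear_coord coord_basis linear_snd lattice1_add lattice1_diff subsetD\<close>)
qed

lemma points_halfopen:
  assumes "B \<in> bases lift_V"
  shows "lattice_cone.points B (\<lambda>b. b) (coord B) lattice1 snd {b\<in>B. coord B b p < 0} B n
    = slice {x. halfopen B p x} n"
proof -
  interpret lattice_cone B "\<lambda>b. b" "coord B" lattice1 snd by (rule lattice_cone_basis[OF assms])
  have "expands x" for x
    using coord_expand[OF basesD(2)[OF assms] fin_I, of x] basesD(3)[OF assms] span_lift
    by (simp add: expands_def)
  then show ?thesis by (auto simp: points_def slice_def halfopen_def low_def)
qed

lemma inner_cone_halfopen:
  assumes "generic_cost lift_V w" "generic_dir lift_V p"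
  shows "slice (inner_cone p) n = (\<Union>B\<in>opt_bases lift_V w. slice {x. halfopen B p x} n)"
  using halfopen_iff[OF fin_lift assms] span_lift by (auto simp: slice_def inner_cone_def)

text \<open>In substance the cone is closed. Here this comes from the decomposition: the half-open
  pieces lie in the cone itself.\<close>

lemma inner_cone_subset:
  assumes "generic_cost lift_V w" "generic_dir lift_V p"
  shows "inner_cone p \<subseteq> cone_V"
proof
  fix x assume "x \<in> inner_cone p"
  then obtain B where "B \<in> opt_bases lift_V w" "halfopen B p x"
    using halfopen_iff[OF fin_lift assms, of x] span_lift by (auto simp: inner_cone_def)
  then show "x \<in> cone_V"
    using halfopen_imp_poscone(2)[OF fin_lift opt_basesD(1), of B w x p] span_lift by simp
qed

text \<open>The half-open cones partition \<open>inner_cone p\<close>, and each has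
  \<open>CARD('n) + 1\<close> generators, so the same power of \<open>1 - fps_X\<close> turns every
  one of their series into that of its box.\<close>

lemma hvec_gf:
  assumes w: "generic_cost lift_V w" and p: "generic_dir lift_V p"
  shows "(1 - fps_X) ^ (CARD('n) + 1) * Abs_fps (\<lambda>n. real (card (slice (inner_cone p) n)))
    = Abs_fps (hvec w p)"
proof -
  let ?O = "opt_bases lift_V w"
  let ?J = "\<lambda>B. {b\<in>B. coord B b p < 0}"
  let ?gf = "\<lambda>B. lattice_cone.gf B (\<lambda>b. b) (coord B) lattice1 snd (?J B)"
  have *: "real (card (slice (inner_cone p) n)) = (\<Sum>B\<in>?O. fps_nth (?gf B B) n)" for n
  proof -
    have "card (slice (inner_cone p) n) = (\<Sum>B\<in>?O. card (slice {x. halfopen B p x} n))"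
      unfolding inner_cone_halfopen[OF w p]
    proof (rule card_UN_disjoint[OF finite_opt])
      show "\<forall>B\<in>?O. finite (slice {x. halfopen B p x} n)"
      proof
        fix B assume "B \<in> ?O"
        then have "slice {x. halfopen B p x} n \<subseteq> slice cone_V n"
          using halfopen_imp_poscone(2)[OF fin_lift opt_basesD(1), of B w _ p] span_lift
          by (auto simp: slice_def)
        then show "finite (slice {x. halfopen B p x} n)" using finite_slice finite_subset by blast
      qed
      have "B = B'" if "B \<in> ?O" "B' \<in> ?O" "halfopen B p x" "halfopen B' p x" for B B' x
        using halfopen_unique[OF fin_lift p _ that] span_lift by simp
      then show "\<forall>B\<in>?O. \<forall>B'\<in>?O. B \<noteq> B' \<longrightarrow>
          slice {x. halfopen B p x} n \<inter> slice {x. halfopen B' p x} n = {}"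
        unfolding slice_def by blast
    qed
    moreover have "fps_nth (?gf B B) n = real (card (slice {x. halfopen B p x} n))" if "B \<in> ?O" for B
      using points_halfopen[OF opt_basesD(1)[OF that], of p n]
        lattice_cone.gf_def[OF lattice_cone_basis[OF opt_basesD(1)[OF that]]] by simp
    ultimately show ?thesis by simp
  qed
  have "Abs_fps (\<lambda>n. real (card (slice (inner_cone p) n))) = (\<Sum>B\<in>?O. ?gf B B)"
    by (rule fps_ext) (simp add: * fps_sum_nth)
  then have "(1 - fps_X) ^ (CARD('n) + 1) * Abs_fps (\<lambda>n. real (card (slice (inner_cone p) n)))
      = (\<Sum>B\<in>?O. (1 - fps_X) ^ (CARD('n) + 1) * ?gf B B)"
    by (simp only: sum_distrib_left)
  also have "\<dots> = (\<Sum>B\<in>?O. ?gf B {})"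
  proof (rule sum.cong[OF refl])
    fix B assume "B \<in> ?O"
    then have B: "B \<in> bases lift_V" by (rule opt_basesD(1))
    show "(1 - fps_X) ^ (CARD('n) + 1) * ?gf B B = ?gf B {}"
      using lattice_cone.gf_cone[OF lattice_cone_basis[OF B], of "?J B"]
      unfolding card_basis[OF B] .
  qed
  also have "\<dots> = Abs_fps (hvec w p)"
  proof (rule fps_ext)
    fix n
    have "fps_nth (?gf B {}) n = real (box_card p B n)" if "B \<in> ?O" for B
      using lattice_cone.gf_def[OF lattice_cone_basis[OF opt_basesD(1)[OF that]]]
      by (simp add: box_card_def)
    then show "fps_nth (\<Sum>B\<in>?O. ?gf B {}) n = fps_nth (Abs_fps (hvec w p)) n"
      by (simp add: fps_sum_nth hvec_def)
  qed
  finally show ?thesis .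
qed

text \<open>Ehrhart-Macdonald reciprocity, cone by cone: no coordinate of \<open>p\<close> vanishes,
  so replacing \<open>p\<close> by \<open>- p\<close> complements the set of strict coordinates, and
  \<open>box_reflect\<close> applies.\<close>

lemma hvec_reflect:
  assumes p: "generic_dir lift_V p" and j: "j \<le> CARD('n) + 1"
  shows "hvec w p (CARD('n) + 1 - j) = hvec w (- p) j"
  unfolding hvec_def
proof (rule sum.cong[OF refl])
  fix B assume "B \<in> opt_bases lift_V w"
  then have B: "B \<in> bases lift_V" by (rule opt_basesD(1))
  interpret lattice_cone B "\<lambda>b. b" "coord B" lattice1 snd by (rule lattice_cone_basis[OF B])
  have "{b\<in>B. coord B b p < 0} = B - {b\<in>B. coord B b (- p) < 0}"
    using p B by (force simp: generic_dir_def linear_neg[OF linear_coord[OF basesD(2)[OF B]]])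
  then show "real (box_card p B (CARD('n) + 1 - j)) = real (box_card (- p) B j)"
    using box_reflect[of j "{b\<in>B. coord B b (- p) < 0}"] j card_basis[OF B]
    by (simp add: box_card_def)
qed

lemma hvec_0:
  assumes "j > CARD('n) + 1"
  shows "hvec w p j = 0"
  unfolding hvec_def
proof (rule sum.neutral; rule ballI)
  fix B assume "B \<in> opt_bases lift_V w"
  then have B: "B \<in> bases lift_V" by (rule opt_basesD(1))
  interpret lattice_cone B "\<lambda>b. b" "coord B" lattice1 snd by (rule lattice_cone_basis[OF B])
  have "points {b\<in>B. coord B b p < 0} {} j = {}"
    using ht_box_le[of _ "{b\<in>B. coord B b p < 0}" j] card_basis[OF B] assms by fastforce
  then show "real (box_card p B j) = 0" by (simp add: box_card_def)
qed

text \<open>A positive combination of all generators, scaled to height 1 so that projecting along it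
  has the simple form of \<open>proj\<close>.\<close>

lemma inner_direction_exists:
  "\<exists>q0. generic_dir lift_V (q0, 1) \<and> (q0, 1) \<in> cone_V"
proof -
  obtain l where l: "\<forall>u\<in>lift_V. 0 < l u" "generic_dir lift_V (\<Sum>u\<in>lift_V. l u *\<^sub>R u)"
    using generic_dir_exists[OF fin_lift] by blast
  define q where "q = (\<Sum>u\<in>lift_V. l u *\<^sub>R u)"
  have "q \<in> cone_V" unfolding q_def poscone_def using l(1) by (auto intro!: exI[of _ l] less_imp_le)
  have s: "snd q = (\<Sum>u\<in>lift_V. l u)"
    unfolding q_def linear_sum[OF linear_snd] by (intro sum.cong) (auto simp: snd_lift)
  have "lift_V \<noteq> {}" using span_lift by auto
  then have pos: "0 < snd q" unfolding s using l(1) fin_lift by (intro sum_pos) auto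
  have "generic_dir lift_V (inverse (snd q) *\<^sub>R q)"
    using l(2) pos by (intro generic_dir_scale) (auto simp: q_def)
  moreover have "inverse (snd q) *\<^sub>R q \<in> cone_V"
    using pos by (intro poscone_scale \<open>q \<in> cone_V\<close>) auto
  moreover have "inverse (snd q) *\<^sub>R q = (inverse (snd q) *\<^sub>R fst q, 1)"
    using pos by (simp add: prod_eq_iff)
  ultimately show ?thesis by metis
qed

section \<open>The boundary, seen through the projection\<close>

definition proj :: "real ^ 'n \<Rightarrow> (real ^ 'n) \<times> real \<Rightarrow> real ^ 'n" where
  "proj q x = fst x - snd x *\<^sub>R q"

lemma linear_proj: "linear (proj q)"
  by (rule linearI) (auto simp: proj_def scaleR_add_left scaleR_diff_right)

lemma proj_eqD:
  assumes "proj q x = proj q y"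
  shows "x - y = (snd x - snd y) *\<^sub>R (q, 1)"
  using assms by (simp add: proj_def prod_eq_iff algebra_simps)

lemma proj_lift: "b \<in> proj q ` lift_V \<Longrightarrow> (b + q, 1) \<in> lift_V" "proj q (b + q, 1) = b"
  by (auto simp: proj_def lift_V_def)

lemma inj_proj: "inj_on (proj q) lift_V"
  by (auto simp: inj_on_def proj_def lift_V_def)

lemma span_proj: "span (proj q ` lift_V) = UNIV"
proof -
  have "surj (proj q)"
    by (rule surjI[of _ "\<lambda>x. (x, 0)"]) (simp add: proj_def)
  then show ?thesis using linear_span_image[OF linear_proj, of q lift_V] span_lift by simp
qed

text \<open>Weak duality for constant costs: the total weight of a conical combination is its
  height. Thus the price is a lower bound for the height of every cone point over
  \<open>proj q x\<close>.\<close>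

lemma price_proj_le:
  assumes "T \<in> bases (proj q ` lift_V)" "\<forall>v\<in>proj q ` lift_V. price T (\<lambda>_. 1) v \<le> 1" "x \<in> cone_V"
  shows "price T (\<lambda>_. 1) (proj q x) \<le> snd x"
proof -
  from assms(3) obtain l where l: "\<forall>u\<in>lift_V. 0 \<le> l u" "x = (\<Sum>u\<in>lift_V. l u *\<^sub>R u)"
      "snd x = (\<Sum>u\<in>lift_V. l u)"
    by (rule coneE)
  have "price T (\<lambda>_. 1) (proj q x) = (\<Sum>u\<in>lift_V. l u * price T (\<lambda>_. 1) (proj q u))"
    unfolding l(2) using linear_price[OF basesD(2)[OF assms(1)], of "\<lambda>_. 1"]
    by (simp add: linear_sum[OF linear_proj] linear_cmul[OF linear_proj] linear_sum linear_cmul)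
  also have "\<dots> \<le> (\<Sum>u\<in>lift_V. l u * 1)"
    using l(1) assms(2) by (intro sum_mono mult_left_mono) auto
  finally show ?thesis using l(3) by simp
qed

text \<open>The generators are lifted back to height 1 while coordinates are read off after
  projection; the expansion condition confines \<open>x\<close> to the hyperplane spanned by the
  lifted generators.\<close>

lemma lattice_cone_boundary:
  assumes "T \<in> bases (proj q ` lift_V)"
  shows "lattice_cone T (\<lambda>b. (b + q, 1)) (\<lambda>b x. coord T b (proj q x)) lattice1 snd"
proof -
  note D = basesD[OF assms]
  have fT: "finite T" using D(1) fin_lift finite_subset by blast
  have lin: "linear (\<lambda>x. coord T b (proj q x))" for b
    using linear_compose[OF linear_proj linear_coord[OF D(2)]] by (simp add: o_def)
  have lift: "(b + q, 1) \<in> lift_V" if "b \<in> T" for b using D(1) that proj_lift(1) by blast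
  show ?thesis
  proof (rule lattice_cone.intro)
    fix n
    have "{x \<in> lattice1. x = (\<Sum>i\<in>T. coord T i (proj q x) *\<^sub>R (i + q, 1)) \<and>
        (\<forall>i\<in>T. 0 \<le> coord T i (proj q x)) \<and> snd x = real n} \<subseteq> slice cone_V n"
    proof (clarsimp simp only: slice_def mem_Collect_eq subset_iff)
      fix x
      assume x: "x = (\<Sum>i\<in>T. coord T i (proj q x) *\<^sub>R (i + q, 1))"
        "\<forall>i\<in>T. 0 \<le> coord T i (proj q x)"
      have "(\<Sum>i\<in>T. coord T i (proj q x) *\<^sub>R (i + q, 1)) \<in> cone_V"
        using x(2) lift by (intro poscone_sum poscone_base[OF fin_lift]) auto
      then show "x \<in> cone_V" using x(1) by simp
    qed
    then show "finite {x \<in> lattice1. x = (\<Sum>i\<in>T. coord T i (proj q x) *\<^sub>R (i + q, 1)) \<and>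
        (\<forall>i\<in>T. 0 \<le> coord T i (proj q x)) \<and> snd x = real n}"
      using finite_slice finite_subset by blast
  qed (use D fT lin lift lift_lattice1 in
        \<open>simp_all add: coord_basis linear_snd lattice1_add lattice1_diff subsetD proj_lift\<close>)
qed

definition facet_points :: "real ^ 'n \<Rightarrow> real ^ 'n \<Rightarrow> (real ^ 'n) set \<Rightarrow> nat \<Rightarrow> ((real ^ 'n) \<times> real) set" where
  "facet_points q p T n = lattice_cone.points T (\<lambda>b. (b + q, 1)) (\<lambda>b x. coord T b (proj q x))
     lattice1 snd {b\<in>T. coord T b p < 0} T n"

lemma facet_points_eq:
  assumes "T \<in> bases (proj q ` lift_V)"
  shows "facet_points q p T n = {x \<in> lattice1. x = (\<Sum>b\<in>T. coord T b (proj q x) *\<^sub>R (b + q, 1)) \<and>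
    snd x = real n \<and> halfopen T p (proj q x)}"
proof -
  interpret lattice_cone T "\<lambda>b. (b + q, 1)" "\<lambda>b x. coord T b (proj q x)" lattice1 snd
    by (rule lattice_cone_boundary[OF assms])
  show ?thesis by (auto simp: facet_points_def points_def expands_def low_def halfopen_def)
qed

text \<open>On a line parallel to \<open>(q, 1)\<close>, \<open>x\<close> lies strictly above the
  cone point \<open>y\<close>, which leaves room for a small move downwards.\<close>

lemma inner_cone_proj:
  assumes q: "(q, 1) \<in> cone_V" and y: "y \<in> cone_V" and "proj q x = proj q y" "snd y < snd x"
  shows "x \<in> inner_cone (- (q, 1))"
proof -
  have x: "x = y + (snd x - snd y) *\<^sub>R (q, 1)" using proj_eqD[OF assms(3)] by (simp add: algebra_simps)
  have "\<forall>\<^sub>F r in at_right 0. r < snd x - snd y"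
    using assms(4) by (intro order_tendstoD(2)[OF tendsto_ident_at]) auto
  then have "\<forall>\<^sub>F r in at_right 0. x + r *\<^sub>R - (q, 1) \<in> cone_V"
  proof (rule eventually_mono)
    fix r assume "r < snd x - snd y"
    then have "y + (snd x - snd y - r) *\<^sub>R (q, 1) \<in> cone_V"
      by (intro poscone_add y poscone_scale q) simp
    also have "y + (snd x - snd y - r) *\<^sub>R (q, 1) = (y + (snd x - snd y) *\<^sub>R (q, 1)) + r *\<^sub>R - (q, 1)"
      by (simp add: scaleR_diff_left del: uminus_Pair)
    finally show "x + r *\<^sub>R - (q, 1) \<in> cone_V" using x by simp
  qed
  then show ?thesis by (simp add: inner_cone_def)
qed

text \<open>
  Projecting along \<open>q\<close> maps the boundary of the cone bijectively onto \<open>real ^ 'n\<close>.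
  A half-open decomposition of the latter therefore lifts to one of the boundary.
\<close>

lemma boundary_slice:
  assumes q: "(q, 1) \<in> cone_V"
    and w: "generic_cost (proj q ` lift_V) w"
      "\<forall>T\<in>opt_bases (proj q ` lift_V) w. \<forall>v\<in>proj q ` lift_V. price T (\<lambda>_. 1) v \<le> 1"
    and p: "generic_dir (proj q ` lift_V) p" "p \<in> poscone (proj q ` lift_V)"
  shows "slice (cone_V - inner_cone (- (q, 1))) n = (\<Union>T\<in>opt_bases (proj q ` lift_V) w. facet_points q p T n)"
    (is "?S = ?U")
proof
  let ?W = "proj q ` lift_V"
  have fW: "finite ?W" using fin_lift by simp
  show "?S \<subseteq> ?U"
  proof
    fix x assume "x \<in> ?S"
    then have x: "x \<in> lattice1" "x \<in> cone_V" "x \<notin> inner_cone (- (q, 1))" "snd x = real n"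
      by (auto simp: slice_def)
    have px: "proj q x \<in> poscone ?W" by (rule poscone_image[OF linear_proj inj_proj x(2)])
    have "\<forall>\<^sub>F r in at_right 0. proj q x + r *\<^sub>R p \<in> poscone ?W"
      using eventually_at_right_less[of "0::real"]
      by (rule eventually_mono) (intro poscone_add px poscone_scale p(2), simp)
    then obtain T where T: "T \<in> opt_bases ?W w" "halfopen T p (proj q x)"
      using halfopen_iff[OF fW w(1) p(1), of "proj q x"] span_proj by auto
    have Tb: "T \<in> bases ?W" by (rule opt_basesD(1)[OF T(1)])
    note D = basesD[OF Tb]
    have fT: "finite T" using D(1) fW finite_subset by blast
    \<comment> \<open>The point over \<open>proj q x\<close> on the lifted simplicial cone. Its
      height is the price, hence at most that of \<open>x\<close>.\<close>
    define y where "y = (\<Sum>b\<in>T. coord T b (proj q x) *\<^sub>R (b + q, 1::real))"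
    have y: "y \<in> cone_V" unfolding y_def
    proof (rule poscone_sum)
      show "0 \<le> coord T b (proj q x)" if "b \<in> T" for b using T(2) that by (simp add: halfopen_def)
      show "(b + q, 1) \<in> cone_V" if "b \<in> T" for b
        using D(1) that proj_lift(1) by (intro poscone_base[OF fin_lift]) blast
    qed
    have "proj q y = (\<Sum>b\<in>T. coord T b (proj q x) *\<^sub>R b)"
      unfolding y_def linear_sum[OF linear_proj] linear_cmul[OF linear_proj] proj_lift(2) ..
    also have "\<dots> = proj q x" using coord_expand[OF D(2) fT] D(3) span_proj by simp
    finally have pxy: "proj q x = proj q y" by simp
    have "snd y = (\<Sum>b\<in>T. coord T b (proj q x))" by (simp add: y_def snd_sum)
    also have "\<dots> = price T (\<lambda>_. 1) (proj q x)"
      using price_coord[OF D(2) fT, of "proj q x" "\<lambda>_. 1"] D(3) span_proj by simp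
    also have "\<dots> \<le> snd x" using price_proj_le[OF Tb _ x(2)] w(2) T(1) by blast
    \<comment> \<open>Were \<open>y\<close> strictly lower, \<open>x\<close> would be an inner
      point.\<close>
    finally have "snd y = snd x" using inner_cone_proj[OF q y pxy] x(3) by force
    then have "x = y" using proj_eqD[OF pxy] by (simp flip: zero_prod_def)
    then have "x \<in> facet_points q p T n"
      unfolding facet_points_eq[OF Tb] using x T(2) y_def by simp
    with T(1) show "x \<in> ?U" by blast
  qed
  show "?U \<subseteq> ?S"
  proof
    fix x assume "x \<in> ?U"
    then obtain T where T: "T \<in> opt_bases ?W w" "x \<in> facet_points q p T n" by blast
    have Tb: "T \<in> bases ?W" by (rule opt_basesD(1)[OF T(1)])
    note D = basesD[OF Tb]
    have fT: "finite T" using D(1) fW finite_subset by blast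
    have x: "x \<in> lattice1" "x = (\<Sum>b\<in>T. coord T b (proj q x) *\<^sub>R (b + q, 1))"
      "snd x = real n" "halfopen T p (proj q x)"
      using T(2) facet_points_eq[OF Tb] by auto
    have "(\<Sum>b\<in>T. coord T b (proj q x) *\<^sub>R (b + q, 1)) \<in> cone_V"
    proof (rule poscone_sum)
      show "0 \<le> coord T b (proj q x)" if "b \<in> T" for b using x(4) that by (simp add: halfopen_def)
      show "(b + q, 1) \<in> cone_V" if "b \<in> T" for b
        using D(1) that proj_lift(1) by (intro poscone_base[OF fin_lift]) blast
    qed
    then have xc: "x \<in> cone_V" using x(2) by simp
    have "snd x = snd (\<Sum>b\<in>T. coord T b (proj q x) *\<^sub>R (b + q, 1))" using x(2) by simp
    also have "\<dots> = (\<Sum>b\<in>T. coord T b (proj q x))" by (simp add: snd_sum)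
    also have "\<dots> = price T (\<lambda>_. 1) (proj q x)"
      using price_coord[OF D(2) fT, of "proj q x" "\<lambda>_. 1"] D(3) span_proj by simp
    finally have price: "price T (\<lambda>_. 1) (proj q x) = snd x" by simp
    \<comment> \<open>The height of \<open>x\<close> already equals the price, the least height of a
      cone point over \<open>proj q x\<close>.\<close>
    have "x \<notin> inner_cone (- (q, 1))"
    proof
      assume "x \<in> inner_cone (- (q, 1))"
      then have "\<forall>\<^sub>F r in at_right 0. x + r *\<^sub>R - (q, 1) \<in> cone_V \<and> 0 < r"
        unfolding inner_cone_def using eventually_at_right_less[of "0::real"]
        by (auto intro: eventually_conj)
      then obtain r where r: "x + r *\<^sub>R - (q, 1) \<in> cone_V" "0 < r"
        using eventually_happens'[OF trivial_limit_at_right_real] by blast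
      have "proj q (x + r *\<^sub>R - (q, 1)) = proj q x" by (simp add: proj_def algebra_simps)
      then have "price T (\<lambda>_. 1) (proj q x) \<le> snd (x + r *\<^sub>R - (q, 1))"
        using price_proj_le[OF Tb _ r(1)] w(2) T(1) by metis
      then show False using price r(2) by simp
    qed
    with xc x show "x \<in> ?S" by (simp add: slice_def)
  qed
qed

text \<open>Bases of the projected configuration have \<open>CARD('n)\<close> elements, one fewer
  than for the cone, so one factor \<open>1 - fps_X\<close> less suffices. That \<open>g\<close>
  counts points, and so is nonnegative, is the source of Hibi's inequality.\<close>

lemma boundary_gf:
  assumes q: "(q, 1) \<in> cone_V"
  shows "\<exists>g. (1 - fps_X) ^ CARD('n) *
    Abs_fps (\<lambda>n. real (card (slice (cone_V - inner_cone (- (q, 1))) n))) = Abs_fps (\<lambda>n. real (g n))"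
proof -
  let ?W = "proj q ` lift_V"
  have fW: "finite ?W" using fin_lift by simp
  obtain w where w: "generic_cost ?W w"
      "\<forall>T\<in>opt_bases ?W w. \<forall>v\<in>?W. price T (\<lambda>_. 1) v \<le> 1"
    using generic_cost_exists[OF fW] by blast
  obtain l where l: "\<forall>v\<in>?W. 0 < l v" "generic_dir ?W (\<Sum>v\<in>?W. l v *\<^sub>R v)"
    using generic_dir_exists[OF fW] by blast
  define p where "p = (\<Sum>v\<in>?W. l v *\<^sub>R v)"
  have p: "generic_dir ?W p" "p \<in> poscone ?W"
    using l unfolding p_def by (blast, intro poscone_sum poscone_base[OF fW]) (auto intro: less_imp_le)
  let ?O = "opt_bases ?W w"
  have finO: "finite ?O"
    using finite_bases[OF fW] by (rule finite_subset[rotated]) (auto simp: opt_bases_def)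
  let ?J = "\<lambda>T. {b\<in>T. coord T b p < 0}"
  let ?gf = "\<lambda>T. lattice_cone.gf T (\<lambda>b. (b + q, 1)) (\<lambda>b x. coord T b (proj q x)) lattice1 snd (?J T)"
  let ?box = "\<lambda>T n. card (lattice_cone.points T (\<lambda>b. (b + q, 1)) (\<lambda>b x. coord T b (proj q x)) lattice1 snd (?J T) {} n)"
  have *: "real (card (slice (cone_V - inner_cone (- (q, 1))) n)) = (\<Sum>T\<in>?O. fps_nth (?gf T T) n)" for n
  proof -
    have "card (slice (cone_V - inner_cone (- (q, 1))) n) = (\<Sum>T\<in>?O. card (facet_points q p T n))"
      unfolding boundary_slice[OF q w p]
    proof (rule card_UN_disjoint[OF finO])
      show "\<forall>T\<in>?O. finite (facet_points q p T n)"
        using lattice_cone.finite_points[OF lattice_cone_boundary[OF opt_basesD(1)]]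
        by (simp add: facet_points_def)
      have "T = T'" if "T \<in> ?O" "T' \<in> ?O" "halfopen T p x" "halfopen T' p x" for T T' x
        using halfopen_unique[OF fW p(1) _ that] span_proj by simp
      then show "\<forall>T\<in>?O. \<forall>T'\<in>?O. T \<noteq> T' \<longrightarrow> facet_points q p T n \<inter> facet_points q p T' n = {}"
        using facet_points_eq[OF opt_basesD(1)] by blast
    qed
    moreover have "fps_nth (?gf T T) n = real (card (facet_points q p T n))" if "T \<in> ?O" for T
      using lattice_cone.gf_def[OF lattice_cone_boundary[OF opt_basesD(1)[OF that]]]
      by (simp add: facet_points_def)
    ultimately show ?thesis by simp
  qed
  have "Abs_fps (\<lambda>n. real (card (slice (cone_V - inner_cone (- (q, 1))) n))) = (\<Sum>T\<in>?O. ?gf T T)"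
    by (rule fps_ext) (simp only: * fps_sum_nth fps_nth_Abs_fps)
  then have "(1 - fps_X) ^ CARD('n) * Abs_fps (\<lambda>n. real (card (slice (cone_V - inner_cone (- (q, 1))) n)))
      = (\<Sum>T\<in>?O. (1 - fps_X) ^ CARD('n) * ?gf T T)"
    by (simp only: sum_distrib_left)
  also have "\<dots> = (\<Sum>T\<in>?O. ?gf T {})"
  proof (rule sum.cong[OF refl])
    fix T assume "T \<in> ?O"
    then have T: "T \<in> bases ?W" by (rule opt_basesD(1))
    have "card T = dim ?W" using T by (intro basis_card_eq_dim) (auto simp: bases_def)
    also have "\<dots> = dim (UNIV :: (real ^ 'n) set)" by (metis dim_span span_proj)
    finally have "card T = CARD('n)" by (simp add: dim_UNIV)
    then show "(1 - fps_X) ^ CARD('n) * ?gf T T = ?gf T {}"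
      using lattice_cone.gf_cone[OF lattice_cone_boundary[OF T], of "?J T"] by simp
  qed
  also have "\<dots> = Abs_fps (\<lambda>n. real (\<Sum>T\<in>?O. ?box T n))"
  proof (rule fps_ext)
    fix n
    have "fps_nth (?gf T {}) n = real (?box T n)" if "T \<in> ?O" for T
      using lattice_cone.gf_def[OF lattice_cone_boundary[OF opt_basesD(1)[OF that]]] by simp
    then show "fps_nth (\<Sum>T\<in>?O. ?gf T {}) n = fps_nth (Abs_fps (\<lambda>n. real (\<Sum>T\<in>?O. ?box T n))) n"
      by (simp add: fps_sum_nth)
  qed
  finally show ?thesis by (rule exI[of _ "\<lambda>n. \<Sum>T\<in>?O. ?box T n"])
qed

section \<open>The h*-vector\<close>

text \<open>
  The last inequality is due to Hibi: the partial sums of \<open>h j - h (d + 1 - j)\<close> are the entries of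
  the h*-vector of the boundary.
\<close>

lemma hstar_exists:
  "\<exists>h. (\<forall>j. 0 \<le> h j) \<and> h 0 = 1 \<and> (\<forall>j>CARD('n). h j = 0) \<and>
    (1 - fps_X) ^ (CARD('n) + 1) * Abs_fps (\<lambda>n. real (card (slice cone_V n))) = Abs_fps h \<and>
    (\<forall>i\<le>CARD('n) + 1. (\<Sum>j\<le>i. h (CARD('n) + 1 - j)) \<le> (\<Sum>j\<le>i. h j))"
proof -
  obtain q0 where q: "generic_dir lift_V (q0, 1)" "(q0, 1) \<in> cone_V"
    using inner_direction_exists by blast
  let ?q = "(q0, 1::real)"
  have q': "generic_dir lift_V (- ?q)" using generic_dir_scale[OF q(1), of "-1"] by simp
  obtain w where w: "generic_cost lift_V w" using generic_cost_exists[OF fin_lift] by blast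
  obtain g where g: "(1 - fps_X) ^ CARD('n) *
      Abs_fps (\<lambda>n. real (card (slice (cone_V - inner_cone (- ?q)) n))) = Abs_fps (\<lambda>n. real (g n))"
    using boundary_gf[OF q(2)] by blast
  define h where "h = hvec w ?q"
  define h' where "h' = hvec w (- ?q)"
  let ?E = "\<lambda>S. Abs_fps (\<lambda>n. real (card (slice S n)))"
  have "cone_V \<subseteq> inner_cone ?q"
  proof
    fix x assume x: "x \<in> cone_V"
    have "\<forall>\<^sub>F r in at_right 0. x + r *\<^sub>R ?q \<in> cone_V"
      using eventually_at_right_less[of "0::real"]
      by (rule eventually_mono) (intro poscone_add x poscone_scale q(2), simp)
    then show "x \<in> inner_cone ?q" by (simp add: inner_cone_def)
  qed
  then have cone: "inner_cone ?q = cone_V" using inner_cone_subset[OF w q(1)] by blast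
  have sub: "inner_cone (- ?q) \<subseteq> cone_V" by (rule inner_cone_subset[OF w q'])
  have E: "(1 - fps_X) ^ (CARD('n) + 1) * ?E cone_V = Abs_fps h"
    using hvec_gf[OF w q(1)] by (simp only: cone h_def)
  have E': "(1 - fps_X) ^ (CARD('n) + 1) * ?E (inner_cone (- ?q)) = Abs_fps h'"
    using hvec_gf[OF w q'] by (simp only: h'_def)
  have split: "?E cone_V = ?E (inner_cone (- ?q)) + ?E (cone_V - inner_cone (- ?q))"
  proof (rule fps_ext)
    fix n
    have "slice cone_V n = slice (inner_cone (- ?q)) n \<union> slice (cone_V - inner_cone (- ?q)) n"
      using sub by (auto simp: slice_def)
    moreover have "finite (slice (inner_cone (- ?q)) n)" "finite (slice (cone_V - inner_cone (- ?q)) n)"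
      using sub by (auto intro!: finite_subset[OF _ finite_slice[of n]] simp: slice_def)
    moreover have "slice (inner_cone (- ?q)) n \<inter> slice (cone_V - inner_cone (- ?q)) n = {}"
      by (auto simp: slice_def)
    ultimately show "fps_nth (?E cone_V) n =
        fps_nth (?E (inner_cone (- ?q)) + ?E (cone_V - inner_cone (- ?q))) n"
      by (simp add: card_Un_disjoint)
  qed
  \<comment> \<open>The additional factor \<open>1 - fps_X\<close> in the series of the cone turns
    \<open>g\<close> into its differences, so partial sums of \<open>h - h'\<close> telescope to
    \<open>g\<close>.\<close>
  have "Abs_fps h = Abs_fps h' + (1 - fps_X) * Abs_fps (\<lambda>n. real (g n))"
    unfolding E[symmetric] E'[symmetric] g[symmetric] split by (simp add: algebra_simps)
  then have hg: "h n = h' n + (real (g n) - (if n = 0 then 0 else real (g (n - 1))))" for n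
    by (auto dest!: arg_cong[where f = "\<lambda>F. fps_nth F n"] simp: left_diff_distrib)
  have sum: "(\<Sum>j\<le>i. h j) = (\<Sum>j\<le>i. h' j) + real (g i)" for i
    by (induction i) (simp_all add: hg)
  have h': "h' j = h (CARD('n) + 1 - j)" if "j \<le> CARD('n) + 1" for j
    using hvec_reflect[OF q(1) that, of w] by (simp add: h_def h'_def)
  have hibi: "(\<Sum>j\<le>i. h (CARD('n) + 1 - j)) \<le> (\<Sum>j\<le>i. h j)" if "i \<le> CARD('n) + 1" for i
  proof -
    have "(\<Sum>j\<le>i. h (CARD('n) + 1 - j)) = (\<Sum>j\<le>i. h' j)"
      using that by (intro sum.cong) (auto simp: h')
    then show ?thesis using sum[of i] by simp
  qed
  have "h 0 = 1"
    using arg_cong[OF E, of "\<lambda>F. fps_nth F 0"] by (simp add: slice_0 fps_power_zeroth)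
  \<comment> \<open>The apex is not an inner point. By reflection this kills the entry of
    \<open>h\<close> at \<open>CARD('n) + 1\<close>, which the boxes alone would allow.\<close>
  have "slice (inner_cone (- ?q)) 0 = {}"
  proof -
    have "0 \<notin> inner_cone (- ?q)"
    proof
      assume "0 \<in> inner_cone (- ?q)"
      then have "\<forall>\<^sub>F r in at_right 0. 0 + r *\<^sub>R - ?q \<in> cone_V \<and> 0 < r"
        unfolding inner_cone_def using eventually_at_right_less[of "0::real"]
        by (auto intro: eventually_conj)
      then obtain r where "0 + r *\<^sub>R - ?q \<in> cone_V" "0 < r"
        using eventually_happens'[OF trivial_limit_at_right_real] by blast
      then show False using snd_cone_nonneg[of "0 + r *\<^sub>R - ?q"] by simp
    qed
    then have "0 \<notin> slice (inner_cone (- ?q)) 0" by (simp add: slice_def)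
    moreover have "slice (inner_cone (- ?q)) 0 \<subseteq> {0}"
      unfolding slice_0[symmetric] using sub by (auto simp: slice_def)
    ultimately show ?thesis by blast
  qed
  then have "h' 0 = 0"
    using arg_cong[OF E', of "\<lambda>F. fps_nth F 0"] by (simp add: fps_power_zeroth)
  then have "h (CARD('n) + 1) = 0" using h'[of 0] by simp
  then have top: "h j = 0" if "j > CARD('n)" for j
    using that hvec_0[of j w ?q] by (cases "j = CARD('n) + 1") (auto simp: h_def)
  have "0 \<le> h j" for j by (auto simp: h_def hvec_def intro: sum_nonneg)
  with \<open>h 0 = 1\<close> top E hibi show ?thesis by blast
qed

lemma ehr_slice:
  assumes "n \<ge> 1"
  shows "ehr (convex hull V) n = card (slice cone_V n)"
  unfolding ehr_def
proof (rule bij_betw_same_card, rule bij_betwI[where g = fst])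
  show "(\<lambda>x. (x, real n)) \<in> (\<lambda>x. real n *\<^sub>R x) ` (convex hull V) \<inter> integer_lattice \<rightarrow> slice cone_V n"
  proof
    fix x assume x: "x \<in> (\<lambda>x. real n *\<^sub>R x) ` (convex hull V) \<inter> integer_lattice"
    then obtain u where u: "\<forall>v\<in>V. 0 \<le> u v" "sum u V = 1" "x = real n *\<^sub>R (\<Sum>v\<in>V. u v *\<^sub>R v)"
      by (auto simp: convex_hull_finite[OF fin_V])
    have "(x, real n) = (\<Sum>v\<in>V. (real n * u v) *\<^sub>R (v, 1))"
      using u by (simp add: prod_eq_iff fst_sum snd_sum scaleR_sum_right flip: sum_distrib_left)
    also have "\<dots> \<in> cone_V"
      using u(1) by (intro poscone_sum poscone_base[OF fin_lift]) (auto simp: lift_V_def)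
    finally show "(x, real n) \<in> slice cone_V n" using x by (auto simp: slice_def lattice1_def)
  qed
  show "fst \<in> slice cone_V n \<rightarrow> (\<lambda>x. real n *\<^sub>R x) ` (convex hull V) \<inter> integer_lattice"
  proof
    fix x assume x: "x \<in> slice cone_V n"
    then obtain l where l: "\<forall>u\<in>lift_V. 0 \<le> l u" "x = (\<Sum>u\<in>lift_V. l u *\<^sub>R u)"
        "real n = (\<Sum>u\<in>lift_V. l u)"
      by (auto simp: slice_def elim!: coneE)
    have inj: "inj_on (\<lambda>v. (v, 1::real)) V" by (auto simp: inj_on_def)
    define u where "u v = l (v, 1) / real n" for v
    have "fst x = (\<Sum>v\<in>V. l (v, 1) *\<^sub>R v)"
      using inj by (simp add: l(2) fst_sum lift_V_def sum.reindex)
    then have "fst x = real n *\<^sub>R (\<Sum>v\<in>V. u v *\<^sub>R v)"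
      using assms by (simp add: u_def scaleR_sum_right)
    moreover have "sum u V = 1"
      using l(3) inj assms by (simp add: u_def lift_V_def sum.reindex flip: sum_divide_distrib)
    moreover have "\<forall>v\<in>V. 0 \<le> u v" using l(1) by (simp add: u_def lift_V_def)
    ultimately show "fst x \<in> (\<lambda>x. real n *\<^sub>R x) ` (convex hull V) \<inter> integer_lattice"
      using x by (auto simp: convex_hull_finite[OF fin_V] slice_def lattice1_def)
  qed
qed (auto simp: slice_def)

end

section \<open>From the h*-vector to the f*-vector\<close>

lemma fps_binomial_inverse:
  "(1 - fps_X) ^ Suc d * Abs_fps (\<lambda>n. real ((n + d) choose d)) = 1"
proof (induction d)
  case 0
  show ?case by (rule fps_ext) (simp add: left_diff_distrib)
next
  case (Suc d)
  have "(1 - fps_X) * Abs_fps (\<lambda>n. real ((n + Suc d) choose Suc d)) = Abs_fps (\<lambda>n. real ((n + d) choose d))"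
  proof (rule fps_ext)
    fix n
    show "fps_nth ((1 - fps_X) * Abs_fps (\<lambda>n. real ((n + Suc d) choose Suc d))) n
        = fps_nth (Abs_fps (\<lambda>n. real ((n + d) choose d))) n"
      by (cases n) (simp_all add: left_diff_distrib)
  qed
  then show ?case using Suc by (simp only: power_Suc2 [of _ "Suc d"] mult.assoc)
qed

lemma hstar_expansion:
  fixes E h :: "nat \<Rightarrow> real"
  assumes "(1 - fps_X) ^ (d + 1) * Abs_fps E = Abs_fps h" "\<forall>j>d. h j = 0"
  shows "E n = (\<Sum>j=0..d. h j * real ((n + d - j) choose d))"
proof -
  let ?F = "Abs_fps (\<lambda>n. real ((n + d) choose d))"
  have "Abs_fps E = ((1 - fps_X) ^ Suc d * ?F) * Abs_fps E" by (simp only: fps_binomial_inverse mult_1)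
  also have "\<dots> = Abs_fps h * ?F" using assms(1) by (simp add: mult_ac)
  finally have "E n = fps_nth (Abs_fps h * ?F) n" by (metis fps_nth_Abs_fps)
  also have "\<dots> = (\<Sum>j=0..n. h j * real ((n + d - j) choose d))"
    by (simp add: fps_mult_nth)
  \<comment> \<open>For \<open>n < j \<le> d\<close> the upper index \<open>n + d - j\<close> is
    below \<open>d\<close>, so the added binomials vanish.\<close>
  also have "\<dots> = (\<Sum>j=0..max n d. h j * real ((n + d - j) choose d))"
    by (rule sum.mono_neutral_left) auto
  also have "\<dots> = (\<Sum>j=0..d. h j * real ((n + d - j) choose d))"
    using assms(2) by (intro sum.mono_neutral_right) auto
  finally show ?thesis .
qed

text \<open>Triangularity: at \<open>n = k + 1\<close> the binomials with lower index above
  \<open>k\<close> vanish, which determines the entries one after the other.\<close>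

lemma binomial_basis_unique:
  fixes f g :: "nat \<Rightarrow> real"
  assumes "\<forall>n\<ge>1. (\<Sum>k=0..d. f k * real ((n - 1) choose k)) = (\<Sum>k=0..d. g k * real ((n - 1) choose k))"
  shows "k \<le> d \<Longrightarrow> f k = g k"
proof (induction k rule: less_induct)
  case (less k)
  have "0 = (\<Sum>i=0..d. (f i - g i) * real (k choose i))"
    using assms[rule_format, of "k + 1"] by (simp add: left_diff_distrib sum_subtractf)
  also have "\<dots> = (\<Sum>i\<in>{k}. (f i - g i) * real (k choose i))"
  proof (rule sum.mono_neutral_right; (intro ballI)?)
    show "(f i - g i) * real (k choose i) = 0" if "i \<in> {0..d} - {k}" for i
      using less.IH[of i] that by (cases "i < k") (auto simp: binomial_eq_0)
  qed (use less.prems in auto)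
  finally show ?case by simp
qed

lemma fstar_from_hstar:
  fixes f h :: "nat \<Rightarrow> real"
  assumes "\<forall>n\<ge>1. (\<Sum>k=0..d. f k * real ((n - 1) choose k)) = (\<Sum>j=0..d. h j * real ((n + d - j) choose d))"
    and "k \<le> d"
  shows "f k = (\<Sum>j=0..d. h j * real ((d + 1 - j) choose (d - k)))"
proof (rule binomial_basis_unique[OF _ assms(2)], intro allI impI)
  fix n :: nat assume n: "1 \<le> n"
  have "(\<Sum>k=0..d. f k * real ((n - 1) choose k)) = (\<Sum>j=0..d. h j * real ((n + d - j) choose d))"
    using assms(1) n by blast
  also have "\<dots> = (\<Sum>j=0..d. h j * (\<Sum>k=0..d. real ((n - 1) choose k) * real ((d + 1 - j) choose (d - k))))"
  proof (rule sum.cong[OF refl])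
    fix j assume "j \<in> {0..d}"
    \<comment> \<open>This splitting of the upper index separates \<open>n - 1\<close>, the argument
      in the f*-expansion, from a part independent of \<open>n\<close>.\<close>
    then have "(n - 1) + (d + 1 - j) = n + d - j" using n by auto
    then have "(n + d - j) choose d = (\<Sum>k=0..d. ((n - 1) choose k) * ((d + 1 - j) choose (d - k)))"
      using vandermonde[of "n - 1" "d + 1 - j" d] by (simp add: atLeast0AtMost)
    then show "h j * real ((n + d - j) choose d) =
        h j * (\<Sum>k=0..d. real ((n - 1) choose k) * real ((d + 1 - j) choose (d - k)))" by simp
  qed
  also have "\<dots> = (\<Sum>k=0..d. (\<Sum>j=0..d. h j * real ((d + 1 - j) choose (d - k))) * real ((n - 1) choose k))"
    unfolding sum_distrib_left sum_distrib_right by (subst sum.swap) (simp add: mult_ac)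
  finally show "(\<Sum>k=0..d. f k * real ((n - 1) choose k)) =
    (\<Sum>k=0..d. (\<Sum>j=0..d. h j * real ((d + 1 - j) choose (d - k))) * real ((n - 1) choose k))" .
qed

section \<open>Inequalities between the entries\<close>

lemma binomial_le_pred:
  assumes "m + 1 \<le> 2 * a"
  shows "m choose a \<le> m choose (a - 1)"
proof (cases "a \<le> m")
  case True
  then show ?thesis using assms by (intro binomial_antimono) auto
qed (simp add: binomial_eq_0)

text \<open>Symmetry replaces \<open>a\<close> by \<open>m - a \<le> b\<close>. If \<open>b\<close>
  is before the middle, the row ascends from \<open>m - a\<close> to \<open>b\<close>; otherwise it
  descends from \<open>b\<close> to \<open>a\<close>.\<close>

lemma binomial_reflected_le:
  assumes "m \<le> a + b" "b \<le> a"
  shows "m choose a \<le> m choose b"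
proof (cases "a \<le> m")
  case True
  show ?thesis
  proof (cases "2 * b \<le> m")
    case b: True
    have "m choose a = m choose (m - a)" using True by (rule binomial_symmetric)
    also have "\<dots> \<le> m choose b" using assms b by (intro binomial_mono) auto
    finally show ?thesis .
  next
    case False
    then show ?thesis using assms True by (intro binomial_antimono) auto
  qed
qed (simp add: binomial_eq_0)

text \<open>For \<open>a = d - k\<close> and \<open>m = d + 1 - j\<close> this is the coefficient of
  \<open>h j\<close> in \<open>f k - f (k + 1)\<close>.\<close>

definition step :: "nat \<Rightarrow> nat \<Rightarrow> real" where
  "step a m = real (m choose a) - real (m choose (a - 1))"

text \<open>By Pascal's rule the increments of \<open>step a\<close> are values of
  \<open>step (a - 1)\<close>, so its shape follows from the unimodality of the rows.\<close>

lemma step_Suc: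
  assumes "2 \<le> a"
  shows "step a (Suc m) - step a m = real (m choose (a - 1)) - real (m choose (a - 2))"
proof -
  obtain b where b: "a = Suc (Suc b)" using le_Suc_ex[OF assms] by auto
  show ?thesis by (simp add: step_def b)
qed

lemma binomial_pred_le:
  assumes "2 * a \<le> m + 1"
  shows "m choose (a - 1) \<le> m choose a"
proof (cases "2 * a \<le> m")
  case True
  then show ?thesis by (intro binomial_mono) auto
next
  case False
  then have "a - 1 \<le> m" "m - (a - 1) = a" using assms by auto
  then show ?thesis using binomial_symmetric[of "a - 1" m] by simp
qed

lemma step_mono:
  assumes "2 \<le> a" "2 * a - 3 \<le> m" "m \<le> m'"
  shows "step a m \<le> step a m'"
  using assms(3)
proof (induction m' rule: dec_induct)
  case (step n)
  have "n choose (a - 1 - 1) \<le> n choose (a - 1)"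
    using step(1) assms by (intro binomial_pred_le) auto
  then show ?case using step_Suc[OF assms(1), of n] step(3) by (simp add: numeral_2_eq_2)
qed simp

text \<open>The increments are nonpositive up to \<open>m = 2 * a - 3\<close>, where they vanish,
  and nonnegative from there on.\<close>

lemma step_min:
  assumes "2 \<le> a"
  shows "step a (2 * a - 2) \<le> step a m"
proof (cases "m \<le> 2 * a - 2")
  case True
  then show ?thesis
  proof (induction m rule: inc_induct)
    case (step n)
    have "n choose (a - 1) \<le> n choose (a - 1 - 1)"
      using step(2) assms by (intro binomial_le_pred) auto
    then show ?case using step_Suc[OF assms, of n] step(3) by (simp add: numeral_2_eq_2)
  qed simp
next
  case False
  then show ?thesis using assms by (intro step_mono) auto
qed

lemma step_middle: "1 \<le> a \<Longrightarrow> step a (2 * a - 1) = 0"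
  using binomial_symmetric[of a "2 * a - 1"] by (simp add: step_def mult_2)

text \<open>As \<open>step a\<close> vanishes at \<open>2 * a - 1\<close>, the depth of its minimum
  is the increment leading to this zero. The next increment is strictly larger, so the value at
  \<open>2 * a\<close> already exceeds the depth.\<close>

lemma step_large:
  assumes "2 \<le> a" "2 * a \<le> m"
  shows "- step a (2 * a - 2) < step a m"
proof -
  obtain b where b: "a = Suc (Suc b)" using le_Suc_ex[OF assms(1)] by auto
  have "- step a (2 * a - 2) = step a (Suc (2 * a - 2)) - step a (2 * a - 2)"
    using step_middle[of a] by (simp add: b)
  also have "\<dots> < step a (Suc (2 * a - 1)) - step a (2 * a - 1)"
  \<comment> \<open>The increments differ by binomials with lower indices \<open>a - 2\<close> and
    \<open>a - 3\<close>; for \<open>a = 2\<close> the latter index is negative.\<close>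
  proof (cases b)
    case 0
    then show ?thesis unfolding step_Suc[OF assms(1)] by (simp add: b)
  next
    case (Suc c)
    have "(2 * a - 2) choose c < (2 * a - 2) choose (Suc c)"
      using Suc b by (intro binomial_strict_mono) auto
    moreover have "2 * a - 1 = Suc (2 * a - 2)" using assms by simp
    ultimately show ?thesis
      unfolding step_Suc[OF assms(1)] by (simp add: b Suc del: mult_Suc_right)
  qed
  also have "\<dots> = step a (2 * a)" using step_middle[of a] assms by simp
  also have "\<dots> \<le> step a m" using assms by (intro step_mono) auto
  finally show ?thesis .
qed

section \<open>Comparing entries through the h*-vector\<close>

locale hstar_inequalities =
  fixes d :: nat and h f :: "nat \<Rightarrow> real"
  assumes d2: "2 \<le> d" and h_nonneg: "\<And>j. 0 \<le> h j" and h_0: "h 0 = 1" and h_top: "\<And>j. d < j \<Longrightarrow> h j = 0"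
    and hibi: "\<And>i. i \<le> d + 1 \<Longrightarrow> (\<Sum>j\<le>i. h (d + 1 - j)) \<le> (\<Sum>j\<le>i. h j)"
    and f_eq: "\<And>k. k \<le> d \<Longrightarrow> f k = (\<Sum>j=0..d. h j * real ((d + 1 - j) choose (d - k)))"
begin

lemma initial_le:
  assumes "2 * k + 2 \<le> d"
  shows "f k \<le> f (k + 1)"
proof -
  have "(d + 1 - j) choose (d - k) \<le> (d + 1 - j) choose (d - (k + 1))" for j
    using binomial_le_pred[of "d + 1 - j" "d - k"] assms by simp
  then show ?thesis using assms h_nonneg
    by (simp add: f_eq) (intro sum_mono mult_left_mono, auto)
qed

text \<open>Strictness comes from \<open>j = 0\<close>, since \<open>h 0 = 1\<close>. At
  \<open>2 * k + 2 = d\<close> the two coefficients for \<open>j = 0\<close> are mirror images and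
  agree, which leaves only the weak inequality there.\<close>

lemma initial_less:
  assumes "2 * k + 3 \<le> d"
  shows "f k < f (k + 1)"
proof -
  have le: "(d + 1 - j) choose (d - k) \<le> (d + 1 - j) choose (d - (k + 1))" for j
    using binomial_le_pred[of "d + 1 - j" "d - k"] assms by simp
  have "(d + 1) choose (d - k) < (d + 1) choose (d - (k + 1))"
    using assms by (intro binomial_strict_antimono) auto
  then have "(\<Sum>j=0..d. h j * real ((d + 1 - j) choose (d - k))) <
      (\<Sum>j=0..d. h j * real ((d + 1 - j) choose (d - (k + 1))))"
    using h_nonneg le
    by (intro sum_strict_mono_ex1 ballI bexI[of _ 0] mult_left_mono) (auto simp: h_0)
  then show ?thesis using assms by (simp only: f_eq)
qed

text \<open>The lower indices \<open>d - k\<close> and \<open>k + 1\<close> add up to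
  \<open>d + 1\<close>, which bounds all upper indices.\<close>

lemma reflected_le:
  assumes "2 * k + 3 \<le> d"
  shows "f k \<le> f (d - 1 - k)"
proof -
  have "(d + 1 - j) choose (d - k) \<le> (d + 1 - j) choose (d - (d - 1 - k))" for j
    using assms by (intro binomial_reflected_le) auto
  then have "(\<Sum>j=0..d. h j * real ((d + 1 - j) choose (d - k))) \<le>
      (\<Sum>j=0..d. h j * real ((d + 1 - j) choose (d - (d - 1 - k))))"
    using h_nonneg by (intro sum_mono mult_left_mono) auto
  then show ?thesis using assms by (simp only: f_eq)
qed

lemma final_greater:
  assumes "3 * d div 4 \<le> k" "k < d"
  shows "f (k + 1) < f k"
proof -
  define a where "a = d - k"
  have a: "1 \<le> a" "4 * a \<le> d + 3" using assms by (auto simp: a_def)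
  have diff: "f k - f (k + 1) = (\<Sum>j=0..d. h j * step a (d + 1 - j))"
    using assms by (simp add: f_eq a_def step_def right_diff_distrib sum_subtractf)
  have "0 < (\<Sum>j=0..d. h j * step a (d + 1 - j))"
  \<comment> \<open>For \<open>a = 1\<close> the coefficient of \<open>h j\<close> is
    \<open>d - j\<close>, never negative; the analysis of \<open>step\<close> starts at
    \<open>a = 2\<close>.\<close>
  proof (cases "a = 1")
    case True
    have "h 0 * step a (d + 1 - 0) \<le> (\<Sum>j=0..d. h j * step a (d + 1 - j))"
      using h_nonneg by (intro member_le_sum) (auto simp: True step_def)
    then show ?thesis using d2 h_0 by (simp add: True step_def)
  next
    case False
    then have a2: "2 \<le> a" using a by simp
    define s where "s = 2 * a - 2"
    define M where "M = - step a s"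
    have s: "2 * s \<le> d" using a by (simp add: s_def)
    have M: "0 \<le> M"
      using step_mono[OF a2, of s "2 * a - 1"] step_middle[of a] a2 by (simp add: M_def s_def)
    \<comment> \<open>A minorant of the coefficients with three levels: \<open>M\<close> on the
      first indices, 0 between, \<open>- M\<close> on the last. Hibi's inequality makes its weighted
      sum nonnegative; \<open>2 * s \<le> d\<close> keeps the two windows apart.\<close>
    define c where "c j = (if j \<le> s then M else 0) - (if d + 1 - s \<le> j then M else 0)" for j
    have low: "(\<Sum>j=0..d. h j * (if j \<le> s then M else 0)) = M * (\<Sum>j\<le>s. h j)"
      unfolding sum_distrib_left using s by (intro sum.mono_neutral_cong_right) auto
    \<comment> \<open>Extending the range to \<open>d + 1\<close> adds \<open>h (d + 1) = 0\<close>
      and gives the window the \<open>s + 1\<close> terms of Hibi's inequality.\<close>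
    have "(\<Sum>j=0..d. h j * (if d + 1 - s \<le> j then M else 0)) = M * (\<Sum>j=d + 1 - s..d + 1. h j)"
      unfolding sum_distrib_left using s h_top by (intro sum.mono_neutral_cong) auto
    also have "(\<Sum>j=d + 1 - s..d + 1. h j) = (\<Sum>j\<le>s. h (d + 1 - j))"
      using s by (intro sum.reindex_bij_witness[of _ "\<lambda>j. d + 1 - j" "\<lambda>j. d + 1 - j"]) auto
    finally have high: "(\<Sum>j=0..d. h j * (if d + 1 - s \<le> j then M else 0))
        = M * (\<Sum>j\<le>s. h (d + 1 - j))" .
    have "0 \<le> M * ((\<Sum>j\<le>s. h j) - (\<Sum>j\<le>s. h (d + 1 - j)))"
      using M hibi[of s] s by simp
    also have "\<dots> = (\<Sum>j=0..d. h j * c j)"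
      unfolding c_def right_diff_distrib sum_subtractf low high ..
    also have "\<dots> < (\<Sum>j=0..d. h j * step a (d + 1 - j))"
    proof (rule sum_strict_mono_ex1)
      show "\<forall>j\<in>{0..d}. h j * c j \<le> h j * step a (d + 1 - j)"
      proof (intro ballI mult_left_mono h_nonneg)
        fix j assume j: "j \<in> {0..d}"
        consider "j \<le> s" | "s < j" "j < d + 1 - s" | "d + 1 - s \<le> j" by linarith
        then show "c j \<le> step a (d + 1 - j)"
        proof cases
          \<comment> \<open>Here \<open>4 * a \<le> d + 3\<close> is needed in full: it puts these
            coefficients in the range of \<open>step_large\<close>.\<close>
          case 1
          then have "2 * a \<le> d + 1 - j" using a by (simp add: s_def)
          then show ?thesis using step_large[OF a2] 1 s by (force simp: c_def M_def s_def)
        next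
          case 2
          then have "2 * a - 1 \<le> d + 1 - j" by (simp add: s_def)
          then have "step a (2 * a - 1) \<le> step a (d + 1 - j)" by (intro step_mono a2) auto
          then show ?thesis using step_middle[of a] a 2 by (simp add: c_def)
        next
          case 3
          then show ?thesis using step_min[OF a2] s by (simp add: c_def M_def s_def)
        qed
      qed
      have "c 0 < step a (d + 1)"
        using step_large[OF a2, of "d + 1"] s a by (auto simp: c_def M_def s_def)
      then show "\<exists>j\<in>{0..d}. h j * c j < h j * step a (d + 1 - j)"
        by (intro bexI[of _ 0]) (auto simp: h_0)
    qed simp
    finally show ?thesis .
  qed
  then show ?thesis using diff by simp
qed

end

theorem theorem1p3:
  fixes P :: "(real ^ 'n) set" and d :: nat and f :: "nat \<Rightarrow> real"
  assumes "d = CARD('n)" and "d \<ge> 2"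
    and "lattice_polytope P" and "aff_dim P = int d"
    and "fstar_vector P f"
  shows "((\<forall>k. k < d div 2 - 1 \<longrightarrow> f k < f (k + 1)) \<and> f (d div 2 - 1) \<le> f (d div 2))
    \<and> (\<forall>k. 3 * d div 4 \<le> k \<and> k < d \<longrightarrow> f k > f (k + 1))
    \<and> (\<forall>k. real k \<le> (real d - 3) / 2 \<longrightarrow> f k \<le> f (d - 1 - k))"
proof -
  obtain V where V: "finite V" "V \<subseteq> integer_lattice" "P = convex hull V"
    using assms(3) by (auto simp: lattice_polytope_def)
  have "aff_dim V = DIM(real ^ 'n)" using assms(1,4) V(3) by (simp add: aff_dim_convex_hull)
  then have "affine hull V = UNIV" by (simp only: aff_dim_eq_full)
  then interpret lattice_config V using V by unfold_locales
  obtain h where h: "\<forall>j. 0 \<le> h j" "h 0 = 1" "\<forall>j>d. h j = 0"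
      "(1 - fps_X) ^ (d + 1) * Abs_fps (\<lambda>n. real (card (slice cone_V n))) = Abs_fps h"
      "\<forall>i\<le>d + 1. (\<Sum>j\<le>i. h (d + 1 - j)) \<le> (\<Sum>j\<le>i. h j)"
    using hstar_exists unfolding assms(1) by blast
  have "(\<Sum>k=0..d. f k * real ((n - 1) choose k)) = (\<Sum>j=0..d. h j * real ((n + d - j) choose d))"
    if "n \<ge> 1" for n
  proof -
    have "(\<Sum>k=0..d. f k * real ((n - 1) choose k)) = real (ehr P n)"
      using assms(1,5) that by (simp add: fstar_vector_def)
    also have "\<dots> = real (card (slice cone_V n))" using ehr_slice[OF that] V(3) by simp
    finally have "(\<Sum>k=0..d. f k * real ((n - 1) choose k)) = real (card (slice cone_V n))" .
    then show ?thesis using hstar_expansion[OF h(4,3)] by simp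
  qed
  then have "f k = (\<Sum>j=0..d. h j * real ((d + 1 - j) choose (d - k)))" if "k \<le> d" for k
    using that by (intro fstar_from_hstar) blast+
  with h(1-3,5) assms(2) interpret hstar_inequalities d h f
    by unfold_locales blast+
  have "f (d div 2 - 1) \<le> f (d div 2)" using initial_le[of "d div 2 - 1"] assms(2) by simp
  moreover have "f k < f (k + 1)" if "k < d div 2 - 1" for k using that by (intro initial_less) simp
  moreover have "f k \<le> f (d - 1 - k)" if "real k \<le> (real d - 3) / 2" for k
  proof (rule reflected_le)
    have "real (2 * k + 3) \<le> real d" using that by simp
    then show "2 * k + 3 \<le> d" by (simp only: of_nat_le_iff)
  qed
  ultimately show ?thesis using final_greater by blast
qed

end
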